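(* Let $n\ge 1$, let $a,b\in\mathbb{R}$ be not both zero, let $T>0$, and let $u=u(x,t)$ be a real-valued function defined on $\mathbb{R}^n\times[0,T)$ such that $$u\in C^k([0,T);H^{3-k}(\mathbb{R}^n))\quad\text{for } k=0,1,$$ and $$q(t):=a\,\|\nabla u(\cdot,t)\|^2+b\neq 0\quad\text{for all } t\in[0,T).$$ If $u$ is a solution of $$u_{tt}-\frac{\Delta u}{\left(a\int_{\mathbb{R}^n}|\nabla u|^2\,dx+b\right)^2}=0\quad\text{in }\mathbb{R}^n\times[0,T),$$ then the functional $$I_3:=q\,\|\Delta u_t\|^2+\frac{\|\nabla(\Delta u)\|^2}{q}-q'\int_{\mathbb{R}^n}\Delta u\,\Delta u_t\,dx+\frac18\,(q')^2\left(q\,\|\nabla u_t\|^2+\frac{\|\Delta u\|^2}{q}\right)-\frac{a}{16}\left(\frac{a^2(s')^4}{4}+q^2(s'')^2\right)$$ remains constant in $[0,T)$, where $s(t):=\|\nabla u(\cdot,t)\|^2$.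
   Context: $\|\cdot\|$ denotes the $L^2(\mathbb{R}^n)$ norm in the space variable $x$, i.e. $\|f\|^2=\int_{\mathbb{R}^n}|f|^2\,dx$. The operators $\nabla$ and $\Delta$ act in $x$; subscripts $t$ denote time derivatives. The functions $s(t)=\|\nabla u(\cdot,t)\|^2$ and $q(t)=a\,s(t)+b$ are functions of $t$ only, and primes denote derivatives in $t$. Under the stated hypotheses one has $s'=2\int_{\mathbb{R}^n}\nabla u\cdot\nabla u_t\,dx$ and $s''=2\|\nabla u_t\|^2-\frac{2}{q^2}\|\Delta u\|^2$. *)

theory Defs
  imports "HOL-Analysis.Analysis"
begin

text \<open>
  Sobolev spaces \<open>H\<^sup>m\<close> of real-valued functions on a Euclidean space are defined through weak
  derivatives tested against compactly supported smooth functions.  Elements of \<open>H\<^sup>m\<close> are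
  represented by functions; every notion below is invariant under modification of these functions
  on Lebesgue null sets.
\<close>

primrec C_k :: "nat \<Rightarrow> ('a::euclidean_space \<Rightarrow> real) \<Rightarrow> bool" where
  "C_k 0 f \<longleftrightarrow> continuous_on UNIV f"
| "C_k (Suc k) f \<longleftrightarrow> (\<forall>x. f differentiable (at x)) \<and>
     (\<forall>i\<in>Basis. C_k k (\<lambda>x. frechet_derivative f (at x) i))"

definition test_function :: "('a::euclidean_space \<Rightarrow> real) \<Rightarrow> bool" where
  "test_function \<phi> \<longleftrightarrow> (\<forall>k. C_k k \<phi>) \<and> (\<exists>K. compact K \<and> (\<forall>x. x \<notin> K \<longrightarrow> \<phi> x = 0))"

definition L2 :: "('a::euclidean_space \<Rightarrow> real) \<Rightarrow> bool" where
  "L2 f \<longleftrightarrow> f \<in> borel_measurable lebesgue \<and> integrable lebesgue (\<lambda>x. (f x)\<^sup>2)"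

definition has_weak_partial ::
    "'a::euclidean_space \<Rightarrow> ('a \<Rightarrow> real) \<Rightarrow> ('a \<Rightarrow> real) \<Rightarrow> bool" where
  "has_weak_partial i f g \<longleftrightarrow> L2 f \<and> L2 g \<and>
     (\<forall>\<phi>. test_function \<phi> \<longrightarrow>
        (\<integral>x. f x * frechet_derivative \<phi> (at x) i \<partial>lebesgue) = - (\<integral>x. g x * \<phi> x \<partial>lebesgue))"

text \<open>A weak derivative is unique up to null sets; a representative is chosen.\<close>

definition weak_partial :: "'a::euclidean_space \<Rightarrow> ('a \<Rightarrow> real) \<Rightarrow> 'a \<Rightarrow> real" where
  "weak_partial i f = (SOME g. has_weak_partial i f g)"

primrec sobolev :: "nat \<Rightarrow> ('a::euclidean_space \<Rightarrow> real) \<Rightarrow> bool" where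
  "sobolev 0 f \<longleftrightarrow> L2 f"
| "sobolev (Suc m) f \<longleftrightarrow> L2 f \<and> (\<forall>i\<in>Basis. \<exists>g. has_weak_partial i f g \<and> sobolev m g)"

text \<open>
  The squared \<open>H\<^sup>m\<close> norm is the sum of \<open>\<parallel>\<partial>\<^sub>i\<^sub>1 \<dots> \<partial>\<^sub>i\<^sub>j f\<parallel>\<^sup>2\<close> over all \<open>j \<le> m\<close> and all index tuples
  \<open>(i\<^sub>1, \<dots>, i\<^sub>j)\<close>; a multi-index derivative is thus counted with its multinomial multiplicity, which
  gives a norm equivalent to the one summing over multi-indices.
\<close>

primrec sobolev_norm_sq :: "nat \<Rightarrow> ('a::euclidean_space \<Rightarrow> real) \<Rightarrow> real" where
  "sobolev_norm_sq 0 f = (\<integral>x. (f x)\<^sup>2 \<partial>lebesgue)"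
| "sobolev_norm_sq (Suc m) f =
     (\<integral>x. (f x)\<^sup>2 \<partial>lebesgue) + (\<Sum>i\<in>Basis. sobolev_norm_sq m (weak_partial i f))"

definition sobolev_norm :: "nat \<Rightarrow> ('a::euclidean_space \<Rightarrow> real) \<Rightarrow> real" where
  "sobolev_norm m f = sqrt (sobolev_norm_sq m f)"

definition grad :: "('a::euclidean_space \<Rightarrow> real) \<Rightarrow> 'a \<Rightarrow> 'a" where
  "grad f x = (\<Sum>i\<in>Basis. weak_partial i f x *\<^sub>R i)"

definition laplacian :: "('a::euclidean_space \<Rightarrow> real) \<Rightarrow> 'a \<Rightarrow> real" where
  "laplacian f x = (\<Sum>i\<in>Basis. weak_partial i (weak_partial i f) x)"

definition L2_norm :: "('a::euclidean_space \<Rightarrow> 'b::real_normed_vector) \<Rightarrow> real" where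
  "L2_norm f = sqrt (\<integral>x. (norm (f x))\<^sup>2 \<partial>lebesgue)"

text \<open>
  A function \<open>u(x,t)\<close> on \<open>\<real>\<^sup>n \<times> [0,T)\<close> is rendered as the curve \<open>t \<mapsto> u t\<close>; only the
  values for \<open>t \<in> {0..<T}\<close> matter.  Time derivatives at \<open>t = 0\<close> are one-sided.
\<close>

definition sobolev_continuous ::
    "real \<Rightarrow> nat \<Rightarrow> (real \<Rightarrow> 'a::euclidean_space \<Rightarrow> real) \<Rightarrow> bool" where
  "sobolev_continuous T m u \<longleftrightarrow> (\<forall>t\<in>{0..<T}. sobolev m (u t) \<and>
     ((\<lambda>r. sobolev_norm m (\<lambda>x. u r x - u t x)) \<longlongrightarrow> 0) (at t within {0..<T}))"

definition has_sobolev_time_derivative ::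
    "real \<Rightarrow> nat \<Rightarrow> (real \<Rightarrow> 'a::euclidean_space \<Rightarrow> real) \<Rightarrow> (real \<Rightarrow> 'a \<Rightarrow> real) \<Rightarrow> bool" where
  "has_sobolev_time_derivative T m u v \<longleftrightarrow>
     (\<forall>t\<in>{0..<T}. sobolev m (u t) \<and> sobolev m (v t) \<and>
       ((\<lambda>r. sobolev_norm m (\<lambda>x. (u r x - u t x) / (r - t) - v t x)) \<longlongrightarrow> 0)
         (at t within {0..<T}))"

text \<open>\<open>u \<in> C\<^sup>k([0,T); H\<^sup>m)\<close>\<close>

primrec C_k_sobolev ::
    "nat \<Rightarrow> real \<Rightarrow> nat \<Rightarrow> (real \<Rightarrow> 'a::euclidean_space \<Rightarrow> real) \<Rightarrow> bool" where
  "C_k_sobolev 0 T m u \<longleftrightarrow> sobolev_continuous T m u"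
| "C_k_sobolev (Suc k) T m u \<longleftrightarrow>
     (\<exists>v. has_sobolev_time_derivative T m u v \<and> C_k_sobolev k T m v)"

definition time_deriv :: "real \<Rightarrow> (real \<Rightarrow> real) \<Rightarrow> real \<Rightarrow> real" where
  "time_deriv T f t = vector_derivative f (at t within {0..<T})"

definition s_fun :: "(real \<Rightarrow> 'a::euclidean_space \<Rightarrow> real) \<Rightarrow> real \<Rightarrow> real" where
  "s_fun u t = (L2_norm (grad (u t)))\<^sup>2"

definition q_fun :: "real \<Rightarrow> real \<Rightarrow> (real \<Rightarrow> 'a::euclidean_space \<Rightarrow> real) \<Rightarrow> real \<Rightarrow> real" where
  "q_fun a b u t = a * s_fun u t + b"

text \<open>
  The equation \<open>u\<^sub>t\<^sub>t - \<Delta>u / q\<^sup>2 = 0\<close>, where \<open>ut\<close> is the time derivative of \<open>u\<close>.  Since \<open>u\<close> is only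
  assumed \<open>C\<^sup>1\<close> in time, \<open>u\<^sub>t\<^sub>t\<close> is understood in the sense of distributions on space: for each time
  \<open>t\<close> and each test function \<open>\<phi>\<close>, \<open>\<langle>u\<^sub>t, \<phi>\<rangle>\<close> is differentiable at \<open>t\<close> with derivative \<open>\<langle>\<Delta>u / q\<^sup>2, \<phi>\<rangle>\<close>.
  Solutions whose \<open>u\<^sub>t\<^sub>t\<close> exists as a derivative in \<open>L\<^sup>2\<close> or \<open>H\<^sup>1\<close> are covered in particular.
\<close>

definition kirchhoff_solution ::
    "real \<Rightarrow> real \<Rightarrow> real \<Rightarrow> (real \<Rightarrow> 'a::euclidean_space \<Rightarrow> real) \<Rightarrow> (real \<Rightarrow> 'a \<Rightarrow> real) \<Rightarrow> bool" where
  "kirchhoff_solution a b T u ut \<longleftrightarrow>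
     (\<forall>t\<in>{0..<T}. \<forall>\<phi>. test_function \<phi> \<longrightarrow>
        ((\<lambda>r. \<integral>x. ut r x * \<phi> x \<partial>lebesgue) has_real_derivative
          (\<integral>x. laplacian (u t) x / (a * (\<integral>y. (norm (grad (u t) y))\<^sup>2 \<partial>lebesgue) + b)\<^sup>2 * \<phi> x
             \<partial>lebesgue))
          (at t within {0..<T}))"

definition I3 ::
    "real \<Rightarrow> real \<Rightarrow> real \<Rightarrow> (real \<Rightarrow> 'a::euclidean_space \<Rightarrow> real) \<Rightarrow> (real \<Rightarrow> 'a \<Rightarrow> real) \<Rightarrow> real \<Rightarrow> real"
  where
  "I3 a b T u ut t =
    (let q = q_fun a b u t;
         q' = time_deriv T (q_fun a b u) t;
         s' = time_deriv T (s_fun u) t;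
         s'' = time_deriv T (time_deriv T (s_fun u)) t
     in q * (L2_norm (laplacian (ut t)))\<^sup>2
        + (L2_norm (grad (laplacian (u t))))\<^sup>2 / q
        - q' * (\<integral>x. laplacian (u t) x * laplacian (ut t) x \<partial>lebesgue)
        + 1 / 8 * q'\<^sup>2 * (q * (L2_norm (grad (ut t)))\<^sup>2 + (L2_norm (laplacian (u t)))\<^sup>2 / q)
        - a / 16 * (a\<^sup>2 * s' ^ 4 / 4 + q\<^sup>2 * s''\<^sup>2))"

end

theory Submission
  imports Defs "HOL-Computational_Algebra.Polynomial"
begin

text \<open>The proof is an energy computation, made rigorous by replacing the two outer space derivatives by
difference quotients. Write \<open>M = \<integral>\<Delta>u \<Delta>u\<^sub>t\<close>. Split the functional into the terms that contain a third
derivative,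
  \<open>E = q \<parallel>\<Delta>u\<^sub>t\<parallel>\<^sup>2 + \<parallel>\<nabla>\<Delta>u\<parallel>\<^sup>2 / q - q' M\<close>,
and the remaining ones, \<open>R\<close>. Once \<open>u\<close> is given, the equation is the linear wave equation
\<open>u\<^sub>t\<^sub>t = \<Delta>u / q\<^sup>2\<close> with a coefficient depending on time only, and for smooth solutions integration by parts
gives \<open>E' = - q'' M\<close>: all other terms cancel in pairs. The nonlinearity enters only through
\<open>q'' = a s''\<close> and \<open>s'' = 2 \<parallel>\<nabla>u\<^sub>t\<parallel>\<^sup>2 - 2 \<parallel>\<Delta>u\<parallel>\<^sup>2 / q\<^sup>2\<close>; together with \<open>(\<parallel>\<nabla>u\<^sub>t\<parallel>\<^sup>2)' = - 2 M / q\<^sup>2\<close> and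
\<open>(\<parallel>\<Delta>u\<parallel>\<^sup>2)' = 2 M\<close> they give \<open>R' = q'' M\<close>, which is the calculation of \<open>lower_part_has_derivative\<close>.

The derivative of \<open>R\<close> exists under the given regularity, but \<open>E\<close> need not be differentiable term by term,
since \<open>\<Delta>u\<^sub>t\<close> and \<open>\<nabla>\<Delta>u\<close> are only continuous in time. Let \<open>\<Delta>\<^sub>h\<close> be the second order difference Laplacian. It is
a bounded operator on \<open>L\<^sup>2\<close> that commutes with weak derivatives, so
  \<open>E\<^sub>h = q \<parallel>\<Delta>\<^sub>h u\<^sub>t\<parallel>\<^sup>2 + \<parallel>\<Delta>\<^sub>h \<nabla>u\<parallel>\<^sup>2 / q - q' \<integral>\<Delta>\<^sub>h u \<Delta>\<^sub>h u\<^sub>t\<close>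
is differentiable and the same cancellation gives \<open>E\<^sub>h' = - q'' \<integral>\<Delta>\<^sub>h u \<Delta>\<^sub>h u\<^sub>t\<close> (\<open>upper_part'\<close>). Hence
\<open>(E\<^sub>h + R)' = q'' (M - \<integral>\<Delta>\<^sub>h u \<Delta>\<^sub>h u\<^sub>t)\<close>. Integrating in time and letting \<open>h\<close> tend to 0, where
\<open>\<parallel>\<Delta>\<^sub>h f\<parallel> \<le> \<Sum>\<^sub>i \<parallel>\<partial>\<^sub>i \<partial>\<^sub>i f\<parallel>\<close> provides the dominating function, shows that \<open>E + R\<close> is constant
(\<open>functional_constant\<close>).

Everything takes place in the inner product space \<open>'a l2\<close> of classes of square integrable functions. Two facts
carry the analysis. Test functions are dense (\<open>test_functions_dense\<close>), and therefore a curve that is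
differentiable against every test function, with a continuous candidate derivative, is differentiable in norm
(\<open>has_vector_derivative_by_test_functions\<close>). Applied to time, this makes \<open>u\<^sub>t\<close> and \<open>\<nabla>u\<^sub>t\<close> differentiable in \<open>L\<^sup>2\<close>,
although the equation is only assumed in the sense of distributions. Applied to the translates of a function, it
identifies weak partial derivatives with derivatives of translation orbits
(\<open>wderiv_orbit_derivative\<close>); integration by parts and the convergence of difference quotients follow from this
and the invariance of Lebesgue measure under translations.\<close>

section \<open>The Hilbert space of square integrable functions\<close>

lemma L2_scale: "L2 f \<Longrightarrow> L2 (\<lambda>x. c * f x)"
  by (auto simp: L2_def power_mult_distrib)

lemma L2_uminus: "L2 f \<Longrightarrow> L2 (\<lambda>x. - f x)"
  using L2_scale[of f "-1"] by simp

lemma L2_mult_integrable: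
  assumes "L2 f" "L2 g"
  shows "integrable lebesgue (\<lambda>x. f x * g x)"
proof (rule Bochner_Integration.integrable_bound)
  show "integrable lebesgue (\<lambda>x. (f x)\<^sup>2 + (g x)\<^sup>2)"
    using assms by (auto simp: L2_def)
  show "(\<lambda>x. f x * g x) \<in> borel_measurable lebesgue"
    using assms by (auto simp: L2_def)
  have "\<bar>f x * g x\<bar> \<le> (f x)\<^sup>2 + (g x)\<^sup>2" for x
  proof -
    have "2 * (\<bar>f x\<bar> * \<bar>g x\<bar>) \<le> (f x)\<^sup>2 + (g x)\<^sup>2"
      using sum_squares_bound[of "\<bar>f x\<bar>" "\<bar>g x\<bar>"] by (simp add: mult.assoc)
    moreover have "0 \<le> \<bar>f x\<bar> * \<bar>g x\<bar>" by simp
    ultimately show ?thesis unfolding abs_mult by linarith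
  qed
  then show "AE x in lebesgue. norm (f x * g x) \<le> norm ((f x)\<^sup>2 + (g x)\<^sup>2)"
    by simp
qed

lemma L2_add:
  assumes "L2 f" "L2 g"
  shows "L2 (\<lambda>x. f x + g x)"
proof -
  have "integrable lebesgue (\<lambda>x. (f x)\<^sup>2 + (g x)\<^sup>2 + 2 * (f x * g x))"
    using assms L2_mult_integrable[OF assms] by (auto simp: L2_def)
  then show ?thesis
    using assms by (auto simp: L2_def power2_sum mult.assoc)
qed

lemma L2_diff: "L2 f \<Longrightarrow> L2 g \<Longrightarrow> L2 (\<lambda>x. f x - g x)"
  using L2_add[OF _ L2_uminus, of f g] by simp

lemma L2_zero: "L2 (\<lambda>x. 0)"
  by (simp add: L2_def)

lemma L2_sum: "(\<And>i. i \<in> I \<Longrightarrow> L2 (f i)) \<Longrightarrow> L2 (\<lambda>x. \<Sum>i\<in>I. f i x)"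
  by (induction I rule: infinite_finite_induct) (auto intro: L2_zero L2_add)

text \<open>Passing to classes makes the inner product definite, so that the calculus of vector valued curves in
\<open>real_inner\<close> spaces applies.\<close>

quotient_type (overloaded) 'a l2 = "'a::euclidean_space \<Rightarrow> real" / partial:
    "\<lambda>f g. L2 f \<and> L2 g \<and> (AE x in lebesgue. f x = g x)"
proof (rule part_equivpI)
  show "\<exists>f::'a \<Rightarrow> real. L2 f \<and> L2 f \<and> (AE x in lebesgue. f x = f x)"
    using L2_zero by auto
  show "symp (\<lambda>f g::'a \<Rightarrow> real. L2 f \<and> L2 g \<and> (AE x in lebesgue. f x = g x))"
    by (auto intro!: sympI)
  show "transp (\<lambda>f g::'a \<Rightarrow> real. L2 f \<and> L2 g \<and> (AE x in lebesgue. f x = g x))"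
    by (intro transpI) (auto elim: AE_mp)
qed

instantiation l2 :: (euclidean_space) real_vector
begin

lift_definition zero_l2 :: "'a l2" is "\<lambda>x. 0" by (simp add: L2_zero)
lift_definition plus_l2 :: "'a l2 \<Rightarrow> 'a l2 \<Rightarrow> 'a l2" is "\<lambda>f g x. f x + g x"
  by (auto intro: L2_add)
lift_definition minus_l2 :: "'a l2 \<Rightarrow> 'a l2 \<Rightarrow> 'a l2" is "\<lambda>f g x. f x - g x"
  by (auto intro: L2_diff)
lift_definition uminus_l2 :: "'a l2 \<Rightarrow> 'a l2" is "\<lambda>f x. - f x"
  by (auto intro: L2_uminus)
lift_definition scaleR_l2 :: "real \<Rightarrow> 'a l2 \<Rightarrow> 'a l2" is "\<lambda>c f x. c * f x"
  by (auto intro: L2_scale)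

instance
proof
  fix F G H :: "'a l2" and a b :: real
  show "F + G + H = F + (G + H)" "F + G = G + F" "0 + F = F" "- F + F = 0" "F - G = F + - G"
    "a *\<^sub>R (F + G) = a *\<^sub>R F + a *\<^sub>R G" "(a + b) *\<^sub>R F = a *\<^sub>R F + b *\<^sub>R F"
    "a *\<^sub>R b *\<^sub>R F = (a * b) *\<^sub>R F" "1 *\<^sub>R F = F"
    by (transfer, auto simp: algebra_simps intro: L2_add L2_scale L2_zero L2_uminus L2_diff)+
qed

end

instantiation l2 :: (euclidean_space) real_inner
begin

lift_definition inner_l2 :: "'a l2 \<Rightarrow> 'a l2 \<Rightarrow> real" is "\<lambda>f g. \<integral>x. f x * g x \<partial>lebesgue"
  by (intro integral_cong_AE) (auto simp: L2_def)

definition norm_l2 :: "'a l2 \<Rightarrow> real" where "norm_l2 F = sqrt (F \<bullet> F)"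
definition dist_l2 :: "'a l2 \<Rightarrow> 'a l2 \<Rightarrow> real" where "dist_l2 F G = norm (F - G)"
definition sgn_l2 :: "'a l2 \<Rightarrow> 'a l2" where "sgn_l2 F = F /\<^sub>R norm F"
definition uniformity_l2 :: "('a l2 \<times> 'a l2) filter" where
  "uniformity_l2 = (INF e\<in>{0 <..}. principal {(x, y). dist x y < e})"
definition open_l2 :: "'a l2 set \<Rightarrow> bool" where
  "open_l2 U \<longleftrightarrow> (\<forall>x\<in>U. eventually (\<lambda>(x', y). x' = x \<longrightarrow> y \<in> U) uniformity)"

instance
proof
  fix F G H :: "'a l2" and a :: real
  show "F \<bullet> G = G \<bullet> F"
    by transfer (simp add: mult.commute)
  show "(F + G) \<bullet> H = F \<bullet> H + G \<bullet> H"
    by transfer (auto simp: distrib_right L2_mult_integrable)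
  show "(a *\<^sub>R F) \<bullet> G = a * (F \<bullet> G)"
    by transfer (auto simp: mult.assoc)
  show "0 \<le> F \<bullet> F"
    by transfer auto
  show "(F \<bullet> F = 0) = (F = 0)"
  proof transfer
    fix f :: "'a \<Rightarrow> real"
    assume f: "L2 f \<and> L2 f \<and> (AE x in lebesgue. f x = f x)"
    then have "(\<integral>x. f x * f x \<partial>lebesgue) = 0 \<longleftrightarrow> (AE x in lebesgue. f x * f x = 0)"
      by (intro integral_nonneg_eq_0_iff_AE) (auto intro: L2_mult_integrable)
    then show "((\<integral>x. f x * f x \<partial>lebesgue) = 0) = (L2 f \<and> L2 (\<lambda>x. 0) \<and> (AE x in lebesgue. f x = 0))"
      using f L2_zero by auto
  qed
  show "norm F = sqrt (F \<bullet> F)" by (rule norm_l2_def)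
  show "dist F G = norm (F - G)" by (rule dist_l2_def)
  show "sgn F = F /\<^sub>R norm F" by (rule sgn_l2_def)
  show "(uniformity :: ('a l2 \<times> 'a l2) filter) = (INF e\<in>{0 <..}. principal {(x, y). dist x y < e})"
    by (rule uniformity_l2_def)
  show "open U = (\<forall>x\<in>U. \<forall>\<^sub>F (x', y) in uniformity. x' = x \<longrightarrow> y \<in> U)" for U :: "'a l2 set"
    by (rule open_l2_def)
qed

end

abbreviation cls :: "('a::euclidean_space \<Rightarrow> real) \<Rightarrow> 'a l2" where
  "cls \<equiv> abs_l2"

lemma inner_cls: "L2 f \<Longrightarrow> L2 g \<Longrightarrow> cls f \<bullet> cls g = (\<integral>x. f x * g x \<partial>lebesgue)"
  by (simp add: inner_l2.abs_eq)

lemma norm_cls_sq: "L2 f \<Longrightarrow> (norm (cls f))\<^sup>2 = (\<integral>x. (f x)\<^sup>2 \<partial>lebesgue)"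
  unfolding power2_norm_eq_inner by (simp add: inner_cls power2_eq_square)

lemma cls_add: "L2 f \<Longrightarrow> L2 g \<Longrightarrow> cls (\<lambda>x. f x + g x) = cls f + cls g"
  by (simp add: plus_l2.abs_eq)

lemma cls_diff: "L2 f \<Longrightarrow> L2 g \<Longrightarrow> cls (\<lambda>x. f x - g x) = cls f - cls g"
  by (simp add: minus_l2.abs_eq)

lemma cls_scale: "L2 f \<Longrightarrow> cls (\<lambda>x. c * f x) = c *\<^sub>R cls f"
  by (simp add: scaleR_l2.abs_eq)

lemma cls_zero: "cls (\<lambda>x. 0) = 0"
  by (simp add: zero_l2_def)

lemma cls_sum: "(\<And>i. i \<in> I \<Longrightarrow> L2 (f i)) \<Longrightarrow> cls (\<lambda>x. \<Sum>i\<in>I. f i x) = (\<Sum>i\<in>I. cls (f i))"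
  by (induction I rule: infinite_finite_induct) (auto simp: cls_zero cls_add L2_sum)

lemma l2_cases: obtains f where "L2 f" "F = cls f"
  by (induction F rule: l2.abs_induct) auto

lemma L2_dominated:
  assumes "L2 g" "f \<in> borel_measurable lebesgue" "\<And>x. \<bar>f x\<bar> \<le> \<bar>g x\<bar>"
  shows "L2 f"
proof -
  have "integrable lebesgue (\<lambda>x. (f x)\<^sup>2)"
  proof (rule Bochner_Integration.integrable_bound)
    show "integrable lebesgue (\<lambda>x. (g x)\<^sup>2)" using assms by (simp add: L2_def)
    show "(\<lambda>x. (f x)\<^sup>2) \<in> borel_measurable lebesgue" using assms by measurable
    show "AE x in lebesgue. norm ((f x)\<^sup>2) \<le> norm ((g x)\<^sup>2)"
      using assms(3) by (auto simp: abs_le_square_iff)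
  qed
  then show ?thesis using assms by (simp add: L2_def)
qed

lemma cls_dominated_convergence:
  assumes "L2 g" "f \<in> borel_measurable lebesgue" "\<And>n. F n \<in> borel_measurable lebesgue"
    and bound: "\<And>n x. \<bar>F n x\<bar> \<le> g x"
    and lim: "\<And>x. (\<lambda>n. F n x) \<longlonglongrightarrow> f x"
  shows "(\<lambda>n. cls (F n)) \<longlonglongrightarrow> cls f" "L2 f" "\<And>n. L2 (F n)"
proof -
  have g0: "0 \<le> g x" for x using bound[of 0 x] by linarith
  have fg: "\<bar>f x\<bar> \<le> g x" for x
    using tendsto_rabs[OF lim[of x]] bound by (intro LIMSEQ_le_const2) auto
  show L: "L2 f" "\<And>n. L2 (F n)"
    using assms fg g0 by (auto intro!: L2_dominated[of g])
  have "(\<lambda>n. \<integral>x. (F n x - f x)\<^sup>2 \<partial>lebesgue) \<longlonglongrightarrow> (\<integral>x. 0 \<partial>(lebesgue :: 'a measure))"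
  proof (rule integral_dominated_convergence)
    show "integrable lebesgue (\<lambda>x. (2 * g x)\<^sup>2)"
      using L2_scale[OF assms(1), of 2] by (simp add: L2_def)
    show "AE x in lebesgue. (\<lambda>n. (F n x - f x)\<^sup>2) \<longlonglongrightarrow> 0"
    proof (intro always_eventually allI)
      fix x
      show "(\<lambda>n. (F n x - f x)\<^sup>2) \<longlonglongrightarrow> 0"
        using tendsto_power[OF tendsto_diff[OF lim[of x] tendsto_const[of "f x"]], of 2] by simp
    qed
    show "AE x in lebesgue. norm ((F n x - f x)\<^sup>2) \<le> (2 * g x)\<^sup>2" for n
    proof (intro always_eventually allI)
      fix x
      have "\<bar>F n x - f x\<bar> \<le> \<bar>2 * g x\<bar>" using bound[of n x] fg[of x] by linarith
      then show "norm ((F n x - f x)\<^sup>2) \<le> (2 * g x)\<^sup>2" by (simp add: abs_le_square_iff)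
    qed
  qed (use assms in auto)
  then have "(\<lambda>n. (norm (cls (F n) - cls f))\<^sup>2) \<longlonglongrightarrow> 0"
    using L by (simp add: cls_diff[symmetric] norm_cls_sq L2_diff)
  then have "(\<lambda>n. sqrt ((norm (cls (F n) - cls f))\<^sup>2)) \<longlonglongrightarrow> sqrt 0"
    by (rule tendsto_real_sqrt)
  then show "(\<lambda>n. cls (F n)) \<longlonglongrightarrow> cls f"
    by (subst tendsto_dist_iff) (simp add: dist_norm)
qed

section \<open>Test functions\<close>

lemma C_k_Suc_lower: "C_k (Suc k) f \<Longrightarrow> C_k k f"
proof (induction k arbitrary: f)
  case 0
  then show ?case
    by (auto simp: continuous_on_eq_continuous_at differentiable_imp_continuous_within)
next
  case (Suc k)
  then show ?case by (metis C_k.simps(2))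
qed

lemma C_k_const: "C_k k (\<lambda>x. c)"
  by (induction k arbitrary: c) auto

lemma C_k_add: "C_k k f \<Longrightarrow> C_k k g \<Longrightarrow> C_k k (\<lambda>x. f x + g x)"
proof (induction k arbitrary: f g)
  case 0
  then show ?case by (auto intro: continuous_intros)
next
  case (Suc k)
  then have d: "frechet_derivative (\<lambda>x. f x + g x) (at x) i
      = frechet_derivative f (at x) i + frechet_derivative g (at x) i" for x i
  proof -
    have "f differentiable (at x)" "g differentiable (at x)" using Suc.prems by auto
    then have "((\<lambda>x. f x + g x) has_derivative
        (\<lambda>h. frechet_derivative f (at x) h + frechet_derivative g (at x) h)) (at x)"
      by (intro has_derivative_add) (simp_all add: frechet_derivative_works)
    from frechet_derivative_at[OF this] show ?thesis by metis
  qed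
  show ?case using Suc by (auto simp: d)
qed

lemma C_k_mult: "C_k k f \<Longrightarrow> C_k k g \<Longrightarrow> C_k k (\<lambda>x. f x * g x)"
proof (induction k arbitrary: f g)
  case 0
  then show ?case by (auto intro: continuous_intros)
next
  case (Suc k)
  then have fg: "f differentiable (at x)" "g differentiable (at x)" for x by auto
  have "((\<lambda>x. f x * g x) has_derivative
      (\<lambda>h. f x * frechet_derivative g (at x) h + frechet_derivative f (at x) h * g x)) (at x)" for x
    using fg by (intro has_derivative_mult) (simp_all add: frechet_derivative_works)
  then have d: "frechet_derivative (\<lambda>x. f x * g x) (at x) =
      (\<lambda>h. f x * frechet_derivative g (at x) h + frechet_derivative f (at x) h * g x)" for x
    by (rule frechet_derivative_at[symmetric])
  have "C_k k f" "C_k k g" using Suc.prems C_k_Suc_lower by blast+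
  then have "C_k k (\<lambda>x. frechet_derivative (\<lambda>x. f x * g x) (at x) i)" if "i \<in> Basis" for i
    unfolding d using Suc.IH Suc.prems that by (intro C_k_add) auto
  moreover have "(\<lambda>x. f x * g x) differentiable (at x)" for x
    using fg by (rule differentiable_mult)
  ultimately show ?case by simp
qed

lemma C_k_diff: "C_k k f \<Longrightarrow> C_k k g \<Longrightarrow> C_k k (\<lambda>x. f x - g x)"
  using C_k_add[of k f "\<lambda>x. (-1) * g x"] C_k_mult[OF C_k_const, of k g "-1"] by simp

lemma C_k_prod: "(\<And>j. j \<in> I \<Longrightarrow> C_k k (f j)) \<Longrightarrow> C_k k (\<lambda>x. \<Prod>j\<in>I. f j x)"
  by (induction I rule: infinite_finite_induct) (auto intro: C_k_const C_k_mult)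

lemma frechet_derivative_shift:
  assumes "f differentiable (at (x + h))"
  shows "(\<lambda>x. f (x + h)) differentiable (at x)"
    and "frechet_derivative (\<lambda>x. f (x + h)) (at x) = frechet_derivative f (at (x + h))"
proof -
  have "(f has_derivative frechet_derivative f (at (x + h))) (at (x + h))"
    using assms by (simp add: frechet_derivative_works)
  then have *: "((\<lambda>x. f (x + h)) has_derivative frechet_derivative f (at (x + h))) (at x)"
    by (rule has_derivative_compose[of "\<lambda>x. x + h" "\<lambda>y. y", rotated])
      (auto intro!: derivative_eq_intros)
  then show "(\<lambda>x. f (x + h)) differentiable (at x)" by (auto simp: differentiable_def)
  show "frechet_derivative (\<lambda>x. f (x + h)) (at x) = frechet_derivative f (at (x + h))"
    using * by (rule frechet_derivative_at[symmetric])
qed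

lemma C_k_shift: "C_k k f \<Longrightarrow> C_k k (\<lambda>x. f (x + h))"
proof (induction k arbitrary: f)
  case 0
  then show ?case by (auto intro!: continuous_on_compose2[of UNIV f] continuous_intros)
next
  case (Suc k)
  then show ?case by (auto simp: frechet_derivative_shift)
qed

text \<open>The sequence \<open>h\<close> lists a smooth function of one real variable with its successive derivatives. Every partial
  derivative of the ridge function is a constant times the ridge function of the next term.\<close>

lemma C_k_ridge:
  fixes v :: "'a::euclidean_space"
  assumes "\<And>m t. (h m has_real_derivative h (Suc m) t) (at t)"
  shows "C_k k (\<lambda>x. h m (x \<bullet> v + c))"
proof (induction k arbitrary: m)
  case 0
  have "continuous_on UNIV (h m)"
    using assms by (meson DERIV_isCont continuous_at_imp_continuous_on)
  then show ?case
    by (auto intro!: continuous_on_compose2[of UNIV "h m"] continuous_intros)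
next
  case (Suc k)
  have *: "((\<lambda>x. h m (x \<bullet> v + c)) has_derivative (\<lambda>y. h (Suc m) (x \<bullet> v + c) * (y \<bullet> v))) (at x)" for x
  proof -
    have "(h m has_derivative (\<lambda>y. h (Suc m) (x \<bullet> v + c) * y)) (at (x \<bullet> v + c))"
      using assms by (simp add: has_field_derivative_def)
    moreover have "((\<lambda>x. x \<bullet> v + c) has_derivative (\<lambda>y. y \<bullet> v)) (at x)"
      by (auto intro!: derivative_eq_intros)
    ultimately show ?thesis
      using has_derivative_compose by fast
  qed
  have d: "frechet_derivative (\<lambda>x. h m (x \<bullet> v + c)) (at x) = (\<lambda>y. h (Suc m) (x \<bullet> v + c) * (y \<bullet> v))" for x
    using * by (rule frechet_derivative_at[symmetric])
  show ?case
    using * by (auto simp: d differentiable_def intro!: C_k_mult C_k_const Suc)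
qed

text \<open>The functions \<open>p(1/t) exp(-1/t)\<close>, extended by 0 to \<open>t \<le> 0\<close>, are closed under differentiation; \<open>p = 1\<close> is the
standard smooth function that vanishes exactly on a half line.\<close>

definition flat :: "real poly \<Rightarrow> real \<Rightarrow> real" where
  "flat p t = (if t > 0 then poly p (1 / t) * exp (- (1 / t)) else 0)"

lemma poly_times_exp_minus_at_top: "((\<lambda>y. poly p y * exp (- y)) \<longlongrightarrow> (0::real)) at_top"
proof -
  have "((\<lambda>y. \<Sum>i\<le>degree p. coeff p i * (y ^ i / exp y)) \<longlongrightarrow> (\<Sum>i\<le>degree p. coeff p i * 0)) at_top"
    by (intro tendsto_intros tendsto_power_div_exp_0)
  then show ?thesis
    by (simp add: poly_altdef sum_distrib_right exp_minus divide_inverse mult.assoc)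
qed

lemma flat_has_derivative:
  "(flat p has_real_derivative flat ([:0, 0, 1:] * (p - pderiv p)) t) (at t)"
proof -
  consider "t < 0" | "t = 0" | "t > 0" by linarith
  then show ?thesis
  proof cases
    case 1
    have "(flat p has_real_derivative 0) (at t)"
    proof (rule has_field_derivative_transform_within_open[of "\<lambda>_. 0"])
      show "open {..<0::real}" by simp
    qed (use 1 in \<open>auto simp: flat_def\<close>)
    then show ?thesis using 1 by (simp add: flat_def)
  next
    case 3
    have "((\<lambda>t. poly p (1 / t) * exp (- (1 / t))) has_real_derivative
        poly ([:0, 0, 1:] * (p - pderiv p)) (1 / t) * exp (- (1 / t))) (at t)"
      using 3 by (auto intro!: derivative_eq_intros simp: field_simps power2_eq_square)
    then have "(flat p has_real_derivative
        poly ([:0, 0, 1:] * (p - pderiv p)) (1 / t) * exp (- (1 / t))) (at t)"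
    proof (rule has_field_derivative_transform_within_open)
      show "open {0::real<..}" by simp
    qed (use 3 in \<open>auto simp: flat_def\<close>)
    then show ?thesis using 3 by (simp add: flat_def)
  next
    case 2
    have "((\<lambda>h. flat p h / h) \<longlongrightarrow> 0) (at 0)"
    proof (rule filterlim_split_at)
      have "((\<lambda>h. 0) \<longlongrightarrow> (0::real)) (at_left 0)" by simp
      then show "((\<lambda>h. flat p h / h) \<longlongrightarrow> 0) (at_left 0)"
        by (rule Lim_transform_eventually)
          (auto simp: flat_def eventually_at_filter intro!: always_eventually)
      have "((\<lambda>h. poly (pCons 0 p) (inverse h) * exp (- inverse h)) \<longlongrightarrow> (0::real)) (at_right 0)"
        by (rule filterlim_compose[OF poly_times_exp_minus_at_top filterlim_inverse_at_top_right])
      then show "((\<lambda>h. flat p h / h) \<longlongrightarrow> 0) (at_right 0)"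
        by (rule Lim_transform_eventually)
          (auto simp: flat_def eventually_at_filter field_simps intro!: always_eventually)
    qed
    then show ?thesis using 2 by (simp add: has_field_derivative_iff flat_def)
  qed
qed

lemma C_k_flat:
  fixes v :: "'a::euclidean_space"
  shows "C_k k (\<lambda>x. flat 1 (x \<bullet> v + c))"
proof -
  define h where "h m = flat (((\<lambda>p. [:0, 0, 1:] * (p - pderiv p)) ^^ m) 1)" for m
  have "(h m has_real_derivative h (Suc m) t) (at t)" for m t
    unfolding h_def funpow.simps o_def by (rule flat_has_derivative)
  from C_k_ridge[of h, OF this, of k 0 v c] show ?thesis by (simp add: h_def)
qed

text \<open>The factor \<open>Suc n\<close> turns \<open>exp(-1/t)\<close> into its root of that order, so the bumps increase to the indicator of
the open box while staying below it.\<close>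

definition box_bump :: "nat \<Rightarrow> 'a::euclidean_space \<Rightarrow> 'a \<Rightarrow> 'a \<Rightarrow> real" where
  "box_bump n a b x = (\<Prod>i\<in>Basis. flat 1 (real (Suc n) * (x \<bullet> i - a \<bullet> i)) *
     flat 1 (real (Suc n) * (b \<bullet> i - x \<bullet> i)))"

lemma flat_1_bounds: "0 \<le> flat 1 t" "flat 1 t \<le> 1"
  by (auto simp: flat_def)

lemma box_bump_bounds: "0 \<le> box_bump n a b x" "box_bump n a b x \<le> 1"
  unfolding box_bump_def
  by (auto intro!: prod_nonneg prod_le_1 mult_nonneg_nonneg mult_le_one flat_1_bounds)

lemma box_bump_eq_0: "x \<notin> box a b \<Longrightarrow> box_bump n a b x = 0"
  by (auto simp: box_bump_def mem_box flat_def zero_less_mult_iff)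

lemma C_k_box_bump: "C_k k (box_bump n a b)"
proof -
  have 1: "real (Suc n) * (x \<bullet> i - a \<bullet> i) = x \<bullet> (real (Suc n) *\<^sub>R i) + (- (real (Suc n) * (a \<bullet> i)))"
    for x i by (simp add: algebra_simps)
  have 2: "real (Suc n) * (b \<bullet> i - x \<bullet> i) = x \<bullet> (- real (Suc n) *\<^sub>R i) + real (Suc n) * (b \<bullet> i)"
    for x i by (simp add: algebra_simps)
  show ?thesis
    unfolding box_bump_def 1 2 by (intro C_k_prod C_k_mult C_k_flat)
qed

lemma box_bump_tendsto:
  assumes "x \<in> box a b"
  shows "(\<lambda>n. box_bump n a b x) \<longlonglongrightarrow> 1"
proof -
  have *: "(\<lambda>n. flat 1 (real (Suc n) * t)) \<longlonglongrightarrow> 1" if "t > 0" for t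
  proof -
    have "(\<lambda>n. exp (- (inverse (real (Suc n)) * (1 / t)))) \<longlonglongrightarrow> exp (- (0 * (1 / t)))"
      by (intro tendsto_intros LIMSEQ_inverse_real_of_nat)
    then show ?thesis
      using that by (simp add: flat_def zero_less_mult_iff divide_simps)
  qed
  have "(\<lambda>n. box_bump n a b x) \<longlonglongrightarrow> (\<Prod>i\<in>(Basis::'a set). 1 * 1)"
    unfolding box_bump_def
    by (intro tendsto_prod tendsto_mult *) (use assms in \<open>auto simp: mem_box\<close>)
  then show ?thesis by simp
qed

lemma test_functionD:
  assumes "test_function \<phi>"
  shows "continuous_on UNIV \<phi>" "\<phi> differentiable (at x)" "C_k k \<phi>"
  using assms C_k.simps(1)[of \<phi>] C_k.simps(2)[of 0 \<phi>] unfolding test_function_def by blast+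

lemma test_function_bounded:
  assumes "test_function \<phi>"
  obtains B r where "\<And>x. \<bar>\<phi> x\<bar> \<le> B" "\<And>x. r < norm x \<Longrightarrow> \<phi> x = 0" "0 \<le> B"
proof -
  obtain K where K: "compact K" "\<And>x. x \<notin> K \<Longrightarrow> \<phi> x = 0"
    using assms by (auto simp: test_function_def)
  obtain r where r: "\<And>x. x \<in> K \<Longrightarrow> norm x \<le> r"
    using compact_imp_bounded[OF K(1)] by (auto simp: bounded_iff)
  have "compact (\<phi> ` K)"
    using K test_functionD(1)[OF assms] continuous_on_subset by (blast intro: compact_continuous_image)
  then obtain B where B: "\<And>x. x \<in> K \<Longrightarrow> \<bar>\<phi> x\<bar> \<le> B"
    using compact_imp_bounded by (force simp: bounded_iff)
  have "\<bar>\<phi> x\<bar> \<le> max B 0" for x using B[of x] K(2)[of x] by (cases "x \<in> K") auto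
  moreover have "\<phi> x = 0" if "r < norm x" for x using r[of x] K(2)[of x] that by fastforce
  ultimately show ?thesis using that by force
qed

lemma test_function_measurable: "test_function \<phi> \<Longrightarrow> \<phi> \<in> borel_measurable lebesgue"
  by (intro measurable_completion) (simp add: borel_measurable_continuous_onI test_functionD(1))

lemma integrable_indicator_power2_iff:
  "integrable lebesgue (\<lambda>x. (indicator A x :: real)\<^sup>2) \<longleftrightarrow> integrable lebesgue (indicator A :: _ \<Rightarrow> real)"
proof -
  have "(\<lambda>x. (indicator A x :: real)\<^sup>2) = indicator A"
    by (simp add: indicator_def fun_eq_iff)
  then show ?thesis by simp
qed

lemma L2_scaled_indicator:
  "A \<in> lmeasurable \<Longrightarrow> L2 (\<lambda>x. c * indicator A x)"
  by (rule L2_scale)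
    (auto simp: L2_def integrable_indicator_power2_iff integrable_indicator_iff fmeasurable_def)

lemma L2_test_function:
  assumes "test_function \<phi>"
  shows "L2 \<phi>"
proof -
  obtain B r where B: "\<And>x. \<bar>\<phi> x\<bar> \<le> B" "\<And>x. r < norm x \<Longrightarrow> \<phi> x = 0" "0 \<le> B"
    using test_function_bounded[OF assms] by metis
  show ?thesis
  proof (rule L2_dominated[of "\<lambda>x. B * indicator (cball 0 r) x"])
    show "L2 (\<lambda>x. B * indicator (cball 0 r) x)"
      by (intro L2_scaled_indicator lmeasurable_cball)
    show "\<bar>\<phi> x\<bar> \<le> \<bar>B * indicator (cball 0 r) x\<bar>" for x
      using B by (auto simp: indicator_def not_le)
  qed (rule test_function_measurable[OF assms])
qed

lemma test_function_partial:
  assumes "test_function \<phi>" "i \<in> Basis"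
  shows "test_function (\<lambda>x. frechet_derivative \<phi> (at x) i)"
proof -
  obtain K where K: "compact K" "\<And>x. x \<notin> K \<Longrightarrow> \<phi> x = 0"
    using assms by (auto simp: test_function_def)
  have "frechet_derivative \<phi> (at x) i = 0" if "x \<notin> K" for x
  proof -
    have "(\<phi> has_derivative (\<lambda>h. 0)) (at x)"
    proof (rule has_derivative_transform_within_open)
      show "((\<lambda>x. 0) has_derivative (\<lambda>h. 0)) (at x)" by simp
      show "open (- K)" using K(1) compact_imp_closed by blast
    qed (use that K in auto)
    from frechet_derivative_at[OF this] show ?thesis by metis
  qed
  moreover have "C_k k (\<lambda>x. frechet_derivative \<phi> (at x) i)" for k
    using test_functionD(3)[OF assms(1), of "Suc k"] assms(2) by simp
  ultimately show ?thesis using K by (auto simp: test_function_def)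
qed

lemma test_function_shift:
  assumes "test_function \<phi>"
  shows "test_function (\<lambda>x. \<phi> (x + h))"
proof -
  obtain K where K: "compact K" "\<And>x. x \<notin> K \<Longrightarrow> \<phi> x = 0"
    using assms by (auto simp: test_function_def)
  have "\<phi> (x + h) = 0" if "x \<notin> (\<lambda>y. y - h) ` K" for x
    using that K(2)[of "x + h"] by (metis add_diff_cancel_right' image_eqI)
  moreover have "compact ((\<lambda>y. y - h) ` K)"
    using K by (intro compact_continuous_image continuous_intros)
  ultimately show ?thesis
    using test_functionD(3)[OF assms] by (auto simp: test_function_def intro!: C_k_shift)
qed

lemma test_function_add:
  assumes "test_function \<phi>" "test_function \<psi>"
  shows "test_function (\<lambda>x. \<phi> x + \<psi> x)"
proof -
  obtain K L where "compact K" "\<And>x. x \<notin> K \<Longrightarrow> \<phi> x = 0" "compact L" "\<And>x. x \<notin> L \<Longrightarrow> \<psi> x = 0"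
    using assms by (auto simp: test_function_def)
  then have "compact (K \<union> L)" "\<forall>x. x \<notin> K \<union> L \<longrightarrow> \<phi> x + \<psi> x = 0" by auto
  then show ?thesis
    using assms unfolding test_function_def by (blast intro: C_k_add)
qed

lemma test_function_scale: "test_function \<phi> \<Longrightarrow> test_function (\<lambda>x. c * \<phi> x)"
  by (auto simp: test_function_def intro!: C_k_mult C_k_const)

lemma test_function_zero: "test_function (\<lambda>x. 0)"
  by (auto simp: test_function_def C_k_const)

definition test_classes :: "'a::euclidean_space l2 set" where
  "test_classes = cls ` Collect test_function"

lemma subspace_test_classes: "subspace test_classes"
  unfolding subspace_def test_classes_def
  by (auto simp: cls_add[symmetric] cls_scale[symmetric] L2_test_function
      simp flip: cls_zero intro!: imageI test_function_add test_function_scale test_function_zero)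

section \<open>Density of the test functions\<close>

lemma subspace_closure:
  fixes S :: "'b::real_normed_vector set"
  assumes S: "subspace S"
  shows "subspace (closure S)"
  unfolding subspace_def
proof (intro conjI ballI allI)
  show "0 \<in> closure S" using closure_subset subspace_0[OF S] by blast
next
  fix x y assume "x \<in> closure S" "y \<in> closure S"
  then obtain f g where "\<And>n. f n \<in> S" "f \<longlonglongrightarrow> x" "\<And>n. g n \<in> S" "g \<longlonglongrightarrow> y"
    unfolding closure_sequential by blast
  then have "\<forall>n. f n + g n \<in> S" "(\<lambda>n. f n + g n) \<longlonglongrightarrow> x + y"
    using subspace_add[OF S] by (auto intro: tendsto_add)
  then show "x + y \<in> closure S"
    unfolding closure_sequential by (intro exI[of _ "\<lambda>n. f n + g n"]) auto
next
  fix c :: real and x assume "x \<in> closure S"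
  then obtain f where "\<And>n. f n \<in> S" "f \<longlonglongrightarrow> x"
    unfolding closure_sequential by blast
  then have "\<forall>n. c *\<^sub>R f n \<in> S" "(\<lambda>n. c *\<^sub>R f n) \<longlonglongrightarrow> c *\<^sub>R x"
    using subspace_scale[OF S] by (auto intro: tendsto_intros)
  then show "c *\<^sub>R x \<in> closure S"
    unfolding closure_sequential by (intro exI[of _ "\<lambda>n. c *\<^sub>R f n"]) auto
qed

text \<open>An open set is a countable union of boxes. If \<open>\<beta>\<^sub>j\<close> are bumps for the first \<open>n\<close> boxes, then \<open>1 - \<Prod>(1 - \<beta>\<^sub>j)\<close>
is a test function below the indicator of the set. Letting the bumps sharpen and the number of boxes grow together
gives pointwise convergence to the indicator, hence convergence in norm by domination.\<close>

lemma closure_test_classes_open: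
  assumes "open T" "T \<in> lmeasurable"
  shows "cls (indicator T) \<in> closure test_classes"
proof (cases "T = {}")
  case True
  then have "indicator T = (\<lambda>x. 0::real)" by auto
  then show ?thesis
    using closure_subset subspace_0[OF subspace_test_classes] by (auto simp: cls_zero)
next
  case False
  obtain \<D> where \<D>: "countable \<D>" "\<D> \<subseteq> Pow T" "\<And>X. X \<in> \<D> \<Longrightarrow> \<exists>a b. X = box a b" "\<Union>\<D> = T"
    using open_countable_Union_open_box[OF assms(1)] by metis
  have "\<D> \<noteq> {}" using \<D>(4) False by auto
  then have rng: "range (from_nat_into \<D>) = \<D>" using \<D>(1) by simp
  then have "\<forall>j. \<exists>a b. from_nat_into \<D> j = box a b" using \<D>(3) by blast
  then obtain a b where ab: "\<And>j. from_nat_into \<D> j = box (a j) (b j)" by metis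
  have T: "T = (\<Union>j. box (a j) (b j))" using \<D>(4) rng ab by auto
  define F where "F n x = 1 - (\<Prod>j<n. 1 - box_bump n (a j) (b j) x)" for n x
  have prod01: "0 \<le> (\<Prod>j<n. 1 - box_bump m (a j) (b j) x)" "(\<Prod>j<n. 1 - box_bump m (a j) (b j) x) \<le> 1"
    for n m x using box_bump_bounds by (auto intro!: prod_nonneg prod_le_1)
  have F0: "F n x = 0" if "x \<notin> (\<Union>j<n. box (a j) (b j))" for n x
    using that by (auto simp: F_def box_bump_eq_0)
  have test: "test_function (F n)" for n
    unfolding test_function_def
  proof (intro conjI allI exI[of _ "\<Union>j<n. cbox (a j) (b j)"] impI)
    show "C_k k (F n)" for k
      unfolding F_def by (intro C_k_diff C_k_prod C_k_const C_k_box_bump)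
    show "compact (\<Union>j<n. cbox (a j) (b j))" by (auto intro!: compact_UN)
    show "F n x = 0" if "x \<notin> (\<Union>j<n. cbox (a j) (b j))" for x
      using that box_subset_cbox by (intro F0) blast
  qed
  have "(\<lambda>n. cls (F n)) \<longlonglongrightarrow> cls (indicator T)"
  proof (rule cls_dominated_convergence)
    show "L2 (\<lambda>x. 1 * indicator T x)" using assms(2) by (rule L2_scaled_indicator)
    show "indicator T \<in> borel_measurable lebesgue" using assms(2) by (simp add: fmeasurableD)
    show "F n \<in> borel_measurable lebesgue" for n by (rule test_function_measurable[OF test])
    show "\<bar>F n x\<bar> \<le> 1 * indicator T x" for n x
    proof (cases "x \<in> T")
      case True
      then show ?thesis using prod01[where n=n and m=n and x=x] by (simp add: F_def)
    next
      case False
      then have "F n x = 0" using T by (intro F0) blast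
      then show ?thesis by simp
    qed
    show "(\<lambda>n. F n x) \<longlonglongrightarrow> indicator T x" for x
    proof (cases "x \<in> T")
      case True
      then obtain j where j: "x \<in> box (a j) (b j)" using T by blast
      have "(\<lambda>n. \<Prod>j<n. 1 - box_bump n (a j) (b j) x) \<longlonglongrightarrow> 0"
      proof (rule tendsto_sandwich[of "\<lambda>_. 0" _ _ "\<lambda>n. 1 - box_bump n (a j) (b j) x"])
        show "\<forall>\<^sub>F n in sequentially. (\<Prod>j<n. 1 - box_bump n (a j) (b j) x) \<le> 1 - box_bump n (a j) (b j) x"
          using eventually_gt_at_top[of j]
        proof eventually_elim
          case (elim n)
          have "(\<Prod>j<n. 1 - box_bump n (a j) (b j) x) = (1 - box_bump n (a j) (b j) x) *
              (\<Prod>j\<in>{..<n} - {j}. 1 - box_bump n (a j) (b j) x)"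
            using elim by (intro prod.remove) auto
          also have "\<dots> \<le> (1 - box_bump n (a j) (b j) x) * 1"
            using box_bump_bounds by (intro mult_left_mono prod_le_1) auto
          finally show ?case by simp
        qed
        show "(\<lambda>n. 1 - box_bump n (a j) (b j) x) \<longlonglongrightarrow> 0"
          using tendsto_diff[OF tendsto_const box_bump_tendsto[OF j], of 1] by simp
      qed (use prod01 in auto)
      from tendsto_diff[OF tendsto_const this, of 1] show ?thesis using True by (simp add: F_def)
    next
      case False
      then have "F n x = 0" for n using T by (intro F0) blast
      then show ?thesis using False by simp
    qed
  qed
  moreover have "cls (F n) \<in> test_classes" for n using test by (auto simp: test_classes_def)
  ultimately show ?thesis
    unfolding closure_sequential by (intro exI[of _ "\<lambda>n. cls (F n)"]) auto
qed

text \<open>By outer regularity, a set of finite measure differs from an open superset by a set of small measure.\<close>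

lemma closure_test_classes_indicator:
  assumes "A \<in> lmeasurable"
  shows "cls (indicator A) \<in> closure test_classes"
proof -
  have "cls (indicator A) \<in> closure (closure test_classes)"
    unfolding closure_approachable
  proof (intro allI impI)
    fix e :: real
    assume e: "e > 0"
    then have "e\<^sup>2 > 0" by simp
    then obtain T where T: "open T" "A \<subseteq> T" "T - A \<in> lmeasurable" "emeasure lebesgue (T - A) < ennreal (e\<^sup>2)"
      using sets_lebesgue_outer_open[OF fmeasurableD[OF assms]] by metis
    have TA: "T = A \<union> (T - A)" using T by auto
    have Tm: "T \<in> lmeasurable"
      by (subst TA) (intro fmeasurable.Un assms T(3))
    have L: "L2 (indicator T)" "L2 (indicator A)"
      using L2_scaled_indicator[OF Tm, of 1] L2_scaled_indicator[OF assms, of 1] by simp_all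
    have "(\<lambda>x. (indicator T x - indicator A x)\<^sup>2) = (indicator (T - A) :: _ \<Rightarrow> real)"
      using T(2) by (auto simp: indicator_def fun_eq_iff)
    then have "(norm (cls (indicator T) - cls (indicator A)))\<^sup>2 = measure lebesgue (T - A)"
      using L T(3) by (simp add: cls_diff[symmetric] norm_cls_sq L2_diff fmeasurableD)
    also have "\<dots> < e\<^sup>2"
      using T(3,4) by (simp add: emeasure_eq_measure2 ennreal_less_iff)
    finally have "dist (cls (indicator T)) (cls (indicator A)) < e"
      using e by (simp add: dist_norm power2_less_imp_less)
    then show "\<exists>y\<in>closure test_classes. dist y (cls (indicator A)) < e"
      using closure_test_classes_open[OF T(1) Tm] by blast
  qed
  then show ?thesis by simp
qed

lemma closure_test_classes_nonneg:
  assumes "f \<in> borel_measurable lebesgue" "\<And>x. 0 \<le> f x"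
  shows "L2 f \<longrightarrow> cls f \<in> closure test_classes"
  using assms
proof (induction rule: borel_measurable_induct_real)
  case (set A)
  show ?case
  proof
    assume "L2 (indicator A)"
    then have "A \<in> lmeasurable"
      using set by (auto simp: L2_def integrable_indicator_power2_iff integrable_indicator_iff fmeasurable_def)
    then show "cls (indicator A) \<in> closure test_classes" by (rule closure_test_classes_indicator)
  qed
next
  case (mult u c)
  show ?case
  proof
    assume L: "L2 (\<lambda>x. c * u x)"
    show "cls (\<lambda>x. c * u x) \<in> closure test_classes"
    proof (cases "c = 0")
      case True
      then show ?thesis
        using closure_subset subspace_0[OF subspace_test_classes] by (auto simp: cls_zero)
    next
      case False
      then have "L2 u" using L2_scale[OF L, of "1 / c"] by simp
      then show ?thesis
        using mult subspace_scale[OF subspace_closure[OF subspace_test_classes]] by (simp add: cls_scale)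
    qed
  qed
next
  case (add u v)
  show ?case
  proof
    assume L: "L2 (\<lambda>x. v x + u x)"
    have "L2 u" "L2 v"
      using add by (auto intro!: L2_dominated[OF L])
    then show "cls (\<lambda>x. v x + u x) \<in> closure test_classes"
      using add subspace_add[OF subspace_closure[OF subspace_test_classes]] by (simp add: cls_add)
  qed
next
  case (seq U)
  show ?case
  proof
    assume L: "L2 f"
    have Uf: "U n x \<le> f x" for n x
      using seq by (intro incseq_le) (auto simp: incseq_def le_fun_def)
    have "\<bar>U n x\<bar> \<le> f x" "(\<lambda>n. U n x) \<longlonglongrightarrow> f x" for n x
      using Uf[of n x] seq(2)[of n x] seq(4) by auto
    note * = cls_dominated_convergence[OF L assms(1) seq(1) this]
    have "\<forall>n. cls (U n) \<in> closure test_classes" using seq(5) *(3) by blast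
    from closed_sequentially[OF closed_closure this[rule_format] *(1)]
    show "cls f \<in> closure test_classes" .
  qed
qed

theorem test_functions_dense:
  fixes F :: "'a::euclidean_space l2"
  assumes "e > 0"
  obtains \<phi> where "test_function \<phi>" "norm (F - cls \<phi>) < e"
proof -
  obtain f where f: "L2 f" "F = cls f" by (rule l2_cases)
  define p n where "p x = max (f x) 0" and "n x = max (- f x) 0" for x
  have pn: "f = (\<lambda>x. p x - n x)" by (auto simp: p_def n_def)
  have m: "p \<in> borel_measurable lebesgue" "n \<in> borel_measurable lebesgue"
    using f(1) by (auto simp: L2_def p_def[abs_def] n_def[abs_def])
  have L: "L2 p" "L2 n"
    using m by (auto intro!: L2_dominated[OF f(1)] simp: p_def n_def)
  then have "cls p \<in> closure test_classes" "cls n \<in> closure test_classes"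
    using closure_test_classes_nonneg[of p] closure_test_classes_nonneg[of n] m
    by (auto simp: p_def n_def)
  then have "cls p - cls n \<in> closure test_classes"
    using subspace_diff[OF subspace_closure[OF subspace_test_classes]] by blast
  then have "F \<in> closure test_classes" using f pn L cls_diff by metis
  then show ?thesis
    using that assms unfolding closure_approachable test_classes_def
    by (auto simp: dist_norm norm_minus_commute)
qed

section \<open>Strong derivatives from derivatives against test functions\<close>

lemma norm_le_by_test_functions:
  assumes "0 \<le> C" "\<And>\<phi>. test_function \<phi> \<Longrightarrow> F \<bullet> cls \<phi> \<le> C * norm (cls \<phi>)"
  shows "norm F \<le> C"
proof -
  have "\<exists>\<phi>. test_function \<phi> \<and> norm (F - cls \<phi>) < inverse (real (Suc n))" for n
    using test_functions_dense[of "inverse (real (Suc n))" F] by auto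
  then obtain \<phi> where \<phi>: "\<And>n. test_function (\<phi> n)" "\<And>n. norm (F - cls (\<phi> n)) < inverse (real (Suc n))"
    by metis
  have "(\<lambda>n. F - cls (\<phi> n)) \<longlonglongrightarrow> 0"
    by (rule Lim_null_comparison[OF _ LIMSEQ_inverse_real_of_nat])
      (intro always_eventually allI less_imp_le \<phi>(2))
  then have lim: "(\<lambda>n. cls (\<phi> n)) \<longlonglongrightarrow> F"
    using tendsto_diff[OF tendsto_const, of "\<lambda>n. F - cls (\<phi> n)" 0 sequentially F] by simp
  have "F \<bullet> F \<le> C * norm F"
    by (rule LIMSEQ_le[of "\<lambda>n. F \<bullet> cls (\<phi> n)" _ "\<lambda>n. C * norm (cls (\<phi> n))"])
      (use assms \<phi> in \<open>auto intro!: tendsto_intros lim\<close>)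
  then have "norm F * norm F \<le> C * norm F"
    by (simp add: power2_norm_eq_inner[symmetric] power2_eq_square)
  then show ?thesis using assms(1) by (cases "norm F = 0") auto
qed

lemma l2_eqI_test_functions:
  assumes "\<And>\<phi>. test_function \<phi> \<Longrightarrow> F \<bullet> cls \<phi> = G \<bullet> cls \<phi>"
  shows "F = G"
  using norm_le_by_test_functions[of 0 "F - G"] assms by (simp add: inner_diff_left)

lemma has_vector_derivative_iff_quotient:
  fixes f :: "real \<Rightarrow> 'b::real_normed_vector"
  shows "(f has_vector_derivative D) (at t within S) \<longleftrightarrow>
    ((\<lambda>r. (1 / (r - t)) *\<^sub>R (f r - f t)) \<longlongrightarrow> D) (at t within S)"
proof -
  have eq: "norm (f r - f t - (r - t) *\<^sub>R D) / norm (r - t) = norm ((1 / (r - t)) *\<^sub>R (f r - f t) - D)"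
    if "r \<noteq> t" for r
  proof -
    have "(1 / (r - t)) *\<^sub>R (f r - f t) - D = (1 / (r - t)) *\<^sub>R (f r - f t - (r - t) *\<^sub>R D)"
      using that by (simp add: scaleR_diff_right)
    then show ?thesis by simp
  qed
  have "((\<lambda>r. norm (f r - f t - (r - t) *\<^sub>R D) / norm (r - t)) \<longlongrightarrow> 0) (at t within S) \<longleftrightarrow>
      ((\<lambda>r. norm ((1 / (r - t)) *\<^sub>R (f r - f t) - D)) \<longlongrightarrow> 0) (at t within S)"
    by (rule tendsto_cong) (use eq in \<open>auto simp: eventually_at_filter intro!: always_eventually\<close>)
  then show ?thesis
    unfolding has_vector_derivative_def has_derivative_iff_norm
    using tendsto_norm_zero_iff[of "\<lambda>r. (1 / (r - t)) *\<^sub>R (f r - f t) - D" "at t within S"]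
      Lim_null[of "\<lambda>r. (1 / (r - t)) *\<^sub>R (f r - f t)" D "at t within S"]
    by (auto intro: bounded_linear_scaleR_left)
qed

text \<open>Pair the error of the linear approximation with a test function: the mean value theorem bounds it by the
oscillation of \<open>F'\<close> times the norm of the test function. The bound is uniform over test functions, so by density
it holds for the norm.\<close>

lemma has_vector_derivative_by_test_functions:
  fixes F F' :: "real \<Rightarrow> 'a::euclidean_space l2"
  assumes S: "convex S" and cont: "continuous_on S F'" and t: "t \<in> S"
    and der: "\<And>\<phi> r. test_function \<phi> \<Longrightarrow> r \<in> S \<Longrightarrow>
      ((\<lambda>r. F r \<bullet> cls \<phi>) has_real_derivative F' r \<bullet> cls \<phi>) (at r within S)"
  shows "(F has_vector_derivative F' t) (at t within S)"
  unfolding has_vector_derivative_def has_derivative_within_alt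
proof (intro conjI allI impI)
  show "bounded_linear (\<lambda>x. x *\<^sub>R F' t)" by (rule bounded_linear_scaleR_left)
  fix e :: real assume e: "e > 0"
  obtain d where d: "d > 0" "\<And>r. r \<in> S \<Longrightarrow> \<bar>r - t\<bar> < d \<Longrightarrow> norm (F' r - F' t) < e"
    using cont t e unfolding continuous_on_iff by (metis dist_norm real_norm_def)
  have "norm (F y - F t - (y - t) *\<^sub>R F' t) \<le> e * norm (y - t)" if y: "y \<in> S" "norm (y - t) < d" for y
  proof (rule norm_le_by_test_functions)
    fix \<phi> :: "'a \<Rightarrow> real" assume \<phi>: "test_function \<phi>"
    define G where "G r = F r \<bullet> cls \<phi> - (r - t) * (F' t \<bullet> cls \<phi>)" for r
    have "norm (G y - G t) \<le> (e * norm (cls \<phi>)) * norm (y - t)"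
    proof (rule field_differentiable_bound)
      show "convex (S \<inter> ball t d)" using S by (intro convex_Int) auto
      show "y \<in> S \<inter> ball t d" "t \<in> S \<inter> ball t d"
        using y t d by (auto simp: dist_norm norm_minus_commute)
      fix r assume r: "r \<in> S \<inter> ball t d"
      have "(G has_field_derivative F' r \<bullet> cls \<phi> - F' t \<bullet> cls \<phi>) (at r within S)"
        unfolding G_def using der[OF \<phi>, of r] r by (auto intro!: derivative_eq_intros)
      then show "(G has_field_derivative (F' r - F' t) \<bullet> cls \<phi>) (at r within (S \<inter> ball t d))"
        by (simp add: inner_diff_left DERIV_subset)
      have "norm (F' r - F' t) \<le> e"
        using d(2)[of r] r by (simp add: dist_real_def abs_minus_commute less_imp_le)
      then have "norm (F' r - F' t) * norm (cls \<phi>) \<le> e * norm (cls \<phi>)"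
        by (rule mult_right_mono) simp
      then show "norm ((F' r - F' t) \<bullet> cls \<phi>) \<le> e * norm (cls \<phi>)"
        using Cauchy_Schwarz_ineq2[of "F' r - F' t" "cls \<phi>"] by simp
    qed
    then show "(F y - F t - (y - t) *\<^sub>R F' t) \<bullet> cls \<phi> \<le> e * norm (y - t) * norm (cls \<phi>)"
      by (simp add: G_def inner_diff_left algebra_simps)
  qed (use e in auto)
  then show "\<exists>d>0. \<forall>y\<in>S. norm (y - t) < d \<longrightarrow> norm (F y - F t - (y - t) *\<^sub>R F' t) \<le> e * norm (y - t)"
    using d(1) by blast
qed

section \<open>Translations\<close>

lemma lebesgue_shift:
  fixes h :: "'a::euclidean_space"
  shows "(\<lambda>x. x + h) \<in> lebesgue \<rightarrow>\<^sub>M lebesgue" "distr lebesgue lebesgue (\<lambda>x. x + h) = lebesgue"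
proof -
  have *: "(\<lambda>x. h + (\<Sum>j\<in>Basis. (1 * (x \<bullet> j)) *\<^sub>R j)) = (\<lambda>x. x + h)"
    by (simp add: euclidean_representation add.commute)
  show "(\<lambda>x. x + h) \<in> lebesgue \<rightarrow>\<^sub>M lebesgue"
    using lebesgue_affine_measurable[of "\<lambda>_. 1" h] unfolding * by simp
  show "distr lebesgue lebesgue (\<lambda>x. x + h) = lebesgue"
    using lebesgue_affine_euclidean[of "\<lambda>_. 1" h] unfolding * by (simp add: density_1)
qed

lemma measurable_shift:
  "f \<in> borel_measurable lebesgue \<Longrightarrow> (\<lambda>x. f (x + h)) \<in> borel_measurable lebesgue"
  using measurable_compose[OF lebesgue_shift(1)] .

lemma AE_shift: "AE x in lebesgue. P x \<Longrightarrow> AE x in lebesgue. P (x + h)"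
  using AE_distrD[OF lebesgue_shift(1), of P h] unfolding lebesgue_shift(2) .

lemma integral_shift:
  fixes f :: "'a::euclidean_space \<Rightarrow> real"
  shows "f \<in> borel_measurable lebesgue \<Longrightarrow> (\<integral>x. f (x + h) \<partial>lebesgue) = (\<integral>x. f x \<partial>lebesgue)"
  using integral_distr[OF lebesgue_shift(1), of f h] by (simp add: lebesgue_shift(2))

lemma L2_shift: "L2 f \<Longrightarrow> L2 (\<lambda>x. f (x + h))"
  using integrable_distr_eq[OF lebesgue_shift(1), of "\<lambda>x. (f x)\<^sup>2" h]
  by (auto simp: L2_def lebesgue_shift(2) measurable_shift)

lift_definition tr :: "'a::euclidean_space \<Rightarrow> 'a l2 \<Rightarrow> 'a l2" is "\<lambda>h f x. f (x + h)"
  subgoal for h f g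
    using AE_shift[of "\<lambda>x. f x = g x" h] by (blast intro: L2_shift)
  done

lemma tr_cls: "L2 f \<Longrightarrow> tr h (cls f) = cls (\<lambda>x. f (x + h))"
  by (simp add: tr.abs_eq)

lemma tr_add: "tr h (F + G) = tr h F + tr h G"
  by transfer (auto intro: L2_add L2_shift)

lemma tr_scaleR: "tr h (c *\<^sub>R F) = c *\<^sub>R tr h F"
  by transfer (auto intro: L2_scale L2_shift)

lemma tr_tr: "tr h (tr k F) = tr (h + k) F"
  by transfer (auto intro: L2_shift simp: add.assoc add.commute[of h])

lemma tr_0 [simp]: "tr 0 F = F"
  by transfer auto

lemma inner_tr_tr: "tr h F \<bullet> tr h G = F \<bullet> G"
  by transfer (auto simp: L2_def intro!: integral_shift)

lemma norm_tr [simp]: "norm (tr h F) = norm F"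
  by (simp add: norm_eq_sqrt_inner inner_tr_tr)

lemma inner_tr_left: "tr h F \<bullet> G = F \<bullet> tr (- h) G"
  using inner_tr_tr[of h F "tr (- h) G"] by (simp add: tr_tr)

lemma bounded_linear_tr: "bounded_linear (tr h)"
  by (rule bounded_linear_intro[of _ 1]) (auto simp: tr_add tr_scaleR)

lemma tr_diff: "tr h (F - G) = tr h F - tr h G"
  using bounded_linear.linear[OF bounded_linear_tr] by (rule linear_diff)

lemma test_function_line_derivative:
  assumes "test_function \<phi>"
  shows "((\<lambda>s. \<phi> (x + s *\<^sub>R i)) has_real_derivative frechet_derivative \<phi> (at (x + s *\<^sub>R i)) i) (at s)"
proof -
  have d: "(\<phi> has_derivative frechet_derivative \<phi> (at (x + s *\<^sub>R i))) (at (x + s *\<^sub>R i))"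
    using test_functionD(2)[OF assms] by (simp add: frechet_derivative_works)
  have "((\<lambda>s. \<phi> (x + s *\<^sub>R i)) has_derivative (\<lambda>h. frechet_derivative \<phi> (at (x + s *\<^sub>R i)) (h *\<^sub>R i))) (at s)"
  proof -
    have "((\<lambda>s. x + s *\<^sub>R i) has_derivative (\<lambda>h. h *\<^sub>R i)) (at s)"
      by (auto intro!: derivative_eq_intros)
    then show ?thesis using d has_derivative_compose by fast
  qed
  then show ?thesis
    using linear_cmul[OF bounded_linear.linear[OF has_derivative_bounded_linear[OF d]]]
    by (simp add: has_field_derivative_def mult.commute[of _ "frechet_derivative _ _ _"])
qed

text \<open>The difference quotients of a test function converge pointwise. The mean value theorem bounds them by the supremum of
the derivative, and along a bounded sequence of steps they vanish outside a common ball.\<close>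

lemma tr_test_has_derivative_0:
  assumes \<phi>: "test_function \<phi>" and i: "i \<in> Basis"
  shows "((\<lambda>s. tr (s *\<^sub>R i) (cls \<phi>)) has_vector_derivative cls (\<lambda>x. frechet_derivative \<phi> (at x) i)) (at 0)"
  unfolding has_vector_derivative_iff_quotient tendsto_at_iff_sequentially
proof (intro allI impI)
  fix X :: "nat \<Rightarrow> real"
  assume X: "\<forall>n. X n \<in> UNIV - {0}" "X \<longlonglongrightarrow> 0"
  let ?d = "\<lambda>x. frechet_derivative \<phi> (at x) i"
  obtain B r' where B: "\<And>x. \<bar>?d x\<bar> \<le> B"
    using test_function_bounded[OF test_function_partial[OF \<phi> i]] by metis
  obtain B' r where r: "\<And>x. r < norm x \<Longrightarrow> \<phi> x = 0"
    using test_function_bounded[OF \<phi>] by metis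
  obtain R where R: "\<And>n. \<bar>X n\<bar> \<le> R"
    using convergent_imp_Bseq[OF convergentI[OF X(2)]] unfolding Bseq_def by auto
  have "(\<lambda>n. cls (\<lambda>x. (1 / X n) * (\<phi> (x + X n *\<^sub>R i) - \<phi> x))) \<longlonglongrightarrow> cls ?d"
  proof (rule cls_dominated_convergence)
    show "L2 (\<lambda>x. B * indicator (cball 0 (r + R)) x)"
      by (intro L2_scaled_indicator lmeasurable_cball)
    show "?d \<in> borel_measurable lebesgue"
      by (rule test_function_measurable[OF test_function_partial[OF \<phi> i]])
    show "(\<lambda>x. (1 / X n) * (\<phi> (x + X n *\<^sub>R i) - \<phi> x)) \<in> borel_measurable lebesgue" for n
      using test_function_measurable[OF \<phi>] measurable_shift[OF test_function_measurable[OF \<phi>], of "X n *\<^sub>R i"]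
      by (intro borel_measurable_times borel_measurable_diff borel_measurable_const)
    show "\<bar>(1 / X n) * (\<phi> (x + X n *\<^sub>R i) - \<phi> x)\<bar> \<le> B * indicator (cball 0 (r + R)) x" for n x
    proof (cases "norm x \<le> r + R")
      case True
      have "norm (\<phi> (x + X n *\<^sub>R i) - \<phi> (x + 0 *\<^sub>R i)) \<le> B * norm (X n - 0)"
        by (rule field_differentiable_bound[of UNIV "\<lambda>s. \<phi> (x + s *\<^sub>R i)" "\<lambda>s. ?d (x + s *\<^sub>R i)"])
          (auto simp: B intro: test_function_line_derivative[OF \<phi>])
      then have "\<bar>\<phi> (x + X n *\<^sub>R i) - \<phi> x\<bar> / \<bar>X n\<bar> \<le> B"
        using X(1) by (simp add: divide_le_eq)
      then show ?thesis using True by (simp add: abs_mult)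
    next
      case False
      have "norm x \<le> norm (x + X n *\<^sub>R i) + norm (X n *\<^sub>R i)"
        using norm_triangle_ineq4[of "x + X n *\<^sub>R i" "X n *\<^sub>R i"] by simp
      then have "r < norm (x + X n *\<^sub>R i)" "r < norm x"
        using False R[of n] i by auto
      then show ?thesis using r False by simp
    qed
    show "(\<lambda>n. (1 / X n) * (\<phi> (x + X n *\<^sub>R i) - \<phi> x)) \<longlonglongrightarrow> ?d x" for x
    proof -
      have "((\<lambda>s. \<phi> (x + s *\<^sub>R i)) has_vector_derivative ?d x) (at 0)"
        using test_function_line_derivative[OF \<phi>, of x i 0]
        by (simp add: has_real_derivative_iff_has_vector_derivative)
      then show ?thesis
        unfolding has_vector_derivative_iff_quotient tendsto_at_iff_sequentially using X by (simp add: o_def)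
    qed
  qed
  moreover have "cls (\<lambda>x. (1 / X n) * (\<phi> (x + X n *\<^sub>R i) - \<phi> x))
      = (1 / X n) *\<^sub>R (tr (X n *\<^sub>R i) (cls \<phi>) - cls \<phi>)" for n
    using L2_test_function[OF \<phi>] by (subst cls_scale) (simp_all add: cls_diff tr_cls L2_shift L2_diff)
  ultimately show "((\<lambda>s. (1 / (s - 0)) *\<^sub>R (tr (s *\<^sub>R i) (cls \<phi>) - tr (0 *\<^sub>R i) (cls \<phi>))) \<circ> X)
      \<longlonglongrightarrow> cls ?d"
    by (simp add: o_def)
qed

text \<open>By the group law, a derivative of a translation orbit at one point gives all the others.\<close>

lemma tr_orbit_has_derivative:
  assumes "((\<lambda>s. tr (s *\<^sub>R i) F) has_vector_derivative G) (at 0)"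
  shows "((\<lambda>s. tr (s *\<^sub>R i) F) has_vector_derivative tr (s *\<^sub>R i) G) (at s)"
proof -
  have "((\<lambda>r. r - s) has_vector_derivative 1) (at s)"
    by (auto intro!: derivative_eq_intros)
  from vector_diff_chain_at[OF this, of "\<lambda>s. tr (s *\<^sub>R i) F" G]
  have "((\<lambda>r. tr ((r - s) *\<^sub>R i) F) has_vector_derivative G) (at s)"
    using assms by (simp add: o_def)
  from bounded_linear.has_vector_derivative[OF bounded_linear_tr[of "s *\<^sub>R i"] this]
  show ?thesis by (simp add: tr_tr scaleR_diff_left)
qed

text \<open>Translations are isometries, so continuity on the dense set of test functions extends to all of \<open>'a l2\<close>.\<close>

lemma tr_continuous:
  assumes i: "i \<in> Basis"
  shows "continuous_on UNIV (\<lambda>s. tr (s *\<^sub>R i) F)"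
proof -
  have 0: "((\<lambda>s. tr (s *\<^sub>R i) F) \<longlongrightarrow> F) (at 0)"
  proof (rule tendstoI)
    fix e :: real assume e: "e > 0"
    obtain \<phi> where \<phi>: "test_function \<phi>" "norm (F - cls \<phi>) < e / 3"
      using test_functions_dense[of "e / 3" F] e by auto
    have "continuous (at 0) (\<lambda>s. tr (s *\<^sub>R i) (cls \<phi>))"
      by (rule has_vector_derivative_continuous[OF tr_test_has_derivative_0[OF \<phi>(1) i]])
    then have "((\<lambda>s. tr (s *\<^sub>R i) (cls \<phi>)) \<longlongrightarrow> cls \<phi>) (at 0)"
      by (simp add: continuous_at)
    then have "\<forall>\<^sub>F s in at 0. dist (tr (s *\<^sub>R i) (cls \<phi>)) (cls \<phi>) < e / 3"
      using e by (intro tendstoD) auto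
    then show "\<forall>\<^sub>F s in at 0. dist (tr (s *\<^sub>R i) F) F < e"
    proof eventually_elim
      case (elim s)
      let ?A = "tr (s *\<^sub>R i) (F - cls \<phi>)" and ?B = "tr (s *\<^sub>R i) (cls \<phi>) - cls \<phi>"
      have "tr (s *\<^sub>R i) F - F = (?A + ?B) - (F - cls \<phi>)"
        by (simp add: tr_diff)
      then have "norm (tr (s *\<^sub>R i) F - F) = norm ((?A + ?B) - (F - cls \<phi>))" by metis
      then have "norm (tr (s *\<^sub>R i) F - F) \<le> norm ?A + norm ?B + norm (F - cls \<phi>)"
        using norm_triangle_ineq4[of "?A + ?B" "F - cls \<phi>"] norm_triangle_ineq[of ?A ?B] by linarith
      then show ?case using \<phi>(2) elim by (simp add: dist_norm)
    qed
  qed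
  have "((\<lambda>r. tr (r *\<^sub>R i) F) \<longlongrightarrow> tr (s *\<^sub>R i) F) (at s)" for s
  proof -
    have "((\<lambda>r. tr (s *\<^sub>R i) (tr (r *\<^sub>R i) F)) \<longlongrightarrow> tr (s *\<^sub>R i) F) (at 0)"
      by (rule bounded_linear.tendsto[OF bounded_linear_tr 0])
    then have "((\<lambda>r. tr ((s + r) *\<^sub>R i) F) \<longlongrightarrow> tr (s *\<^sub>R i) F) (at 0)"
      by (simp add: tr_tr scaleR_add_left)
    then show ?thesis
      using LIM_offset_zero_cancel[of "\<lambda>r. tr (r *\<^sub>R i) F" s] by blast
  qed
  then show ?thesis by (simp add: continuous_on_def)
qed

section \<open>Weak partial derivatives as generators of translations\<close>

text \<open>Weak differentiability depends on classes only. As a relation between two given classes it is closed and linear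
without any choice of a representative.\<close>

definition wderiv :: "'a::euclidean_space \<Rightarrow> 'a l2 \<Rightarrow> 'a l2 \<Rightarrow> bool" where
  "wderiv i F G \<longleftrightarrow> (\<forall>\<phi>. test_function \<phi> \<longrightarrow>
     F \<bullet> cls (\<lambda>x. frechet_derivative \<phi> (at x) i) = - (G \<bullet> cls \<phi>))"

lemma has_weak_partial_iff:
  assumes "i \<in> Basis"
  shows "has_weak_partial i f g \<longleftrightarrow> L2 f \<and> L2 g \<and> wderiv i (cls f) (cls g)"
proof -
  have "cls f \<bullet> cls (\<lambda>x. frechet_derivative \<phi> (at x) i)
      = (\<integral>x. f x * frechet_derivative \<phi> (at x) i \<partial>lebesgue)"
      "cls g \<bullet> cls \<phi> = (\<integral>x. g x * \<phi> x \<partial>lebesgue)"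
    if "L2 f" "L2 g" "test_function \<phi>" for \<phi>
    using that by (simp_all add: inner_cls L2_test_function test_function_partial[OF _ assms])
  then show ?thesis unfolding has_weak_partial_def wderiv_def by auto
qed

lemma wderiv_zero: "wderiv i 0 0"
  by (simp add: wderiv_def)

lemma wderiv_add: "wderiv i F G \<Longrightarrow> wderiv i F' G' \<Longrightarrow> wderiv i (F + F') (G + G')"
  by (simp add: wderiv_def inner_add_left)

lemma wderiv_scaleR: "wderiv i F G \<Longrightarrow> wderiv i (c *\<^sub>R F) (c *\<^sub>R G)"
  by (simp add: wderiv_def)

lemma wderiv_diff: "wderiv i F G \<Longrightarrow> wderiv i F' G' \<Longrightarrow> wderiv i (F - F') (G - G')"
  by (simp add: wderiv_def inner_diff_left)

lemma wderiv_sum: "(\<And>j. j \<in> J \<Longrightarrow> wderiv i (F j) (G j)) \<Longrightarrow> wderiv i (\<Sum>j\<in>J. F j) (\<Sum>j\<in>J. G j)"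
  by (induction J rule: infinite_finite_induct) (auto intro: wderiv_zero wderiv_add)

lemma wderiv_unique: "wderiv i F G \<Longrightarrow> wderiv i F G' \<Longrightarrow> G = G'"
  by (rule l2_eqI_test_functions) (simp add: wderiv_def)

lemma wderiv_closed:
  assumes "F \<longlonglongrightarrow> F'" "G \<longlonglongrightarrow> G'" "\<And>n. wderiv i (F n) (G n)"
  shows "wderiv i F' G'"
  unfolding wderiv_def
proof (intro allI impI)
  fix \<phi> :: "'a \<Rightarrow> real" assume "test_function \<phi>"
  then have eq: "F n \<bullet> cls (\<lambda>x. frechet_derivative \<phi> (at x) i) = - (G n \<bullet> cls \<phi>)" for n
    using assms(3) by (simp add: wderiv_def)
  have "(\<lambda>n. F n \<bullet> cls (\<lambda>x. frechet_derivative \<phi> (at x) i)) \<longlonglongrightarrow> - (G' \<bullet> cls \<phi>)"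
    unfolding eq by (intro tendsto_intros assms)
  moreover have "(\<lambda>n. F n \<bullet> cls (\<lambda>x. frechet_derivative \<phi> (at x) i)) \<longlonglongrightarrow> F' \<bullet> cls (\<lambda>x. frechet_derivative \<phi> (at x) i)"
    by (intro tendsto_intros assms)
  ultimately show "F' \<bullet> cls (\<lambda>x. frechet_derivative \<phi> (at x) i) = - (G' \<bullet> cls \<phi>)"
    by (rule LIMSEQ_unique[symmetric])
qed

lemma wderiv_tr:
  assumes i: "i \<in> Basis" and "wderiv i F G"
  shows "wderiv i (tr h F) (tr h G)"
  unfolding wderiv_def
proof (intro allI impI)
  fix \<phi> :: "'a \<Rightarrow> real" assume \<phi>: "test_function \<phi>"
  let ?\<psi> = "\<lambda>x. \<phi> (x + - h)"
  have d: "frechet_derivative ?\<psi> (at x) = frechet_derivative \<phi> (at (x + - h))" for x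
    by (rule frechet_derivative_shift[OF test_functionD(2)[OF \<phi>]])
  show "tr h F \<bullet> cls (\<lambda>x. frechet_derivative \<phi> (at x) i) = - (tr h G \<bullet> cls \<phi>)"
  proof -
    have "L2 (\<lambda>x. frechet_derivative \<phi> (at x) i)"
      by (rule L2_test_function[OF test_function_partial[OF \<phi> i]])
    then have "tr h F \<bullet> cls (\<lambda>x. frechet_derivative \<phi> (at x) i)
        = F \<bullet> cls (\<lambda>x. frechet_derivative \<phi> (at (x + - h)) i)"
      unfolding inner_tr_left by (simp add: tr_cls)
    also have "\<dots> = F \<bullet> cls (\<lambda>x. frechet_derivative ?\<psi> (at x) i)"
      unfolding d ..
    also have "\<dots> = - (G \<bullet> cls ?\<psi>)"
      using assms test_function_shift[OF \<phi>, of "- h"] unfolding wderiv_def by blast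
    also have "\<dots> = - (tr h G \<bullet> cls \<phi>)"
      unfolding inner_tr_left by (simp add: tr_cls L2_test_function[OF \<phi>])
    finally show ?thesis .
  qed
qed

text \<open>Moving the translation onto the test function, the pairing of an orbit with a test function is differentiable, and
the definition of the weak derivative identifies its derivative with the pairing of the translates of \<open>G\<close>. These
depend continuously on the translation.\<close>

lemma wderiv_orbit_derivative:
  assumes i: "i \<in> Basis" and d: "wderiv i F G"
  shows "((\<lambda>s. tr (s *\<^sub>R i) F) has_vector_derivative tr (s *\<^sub>R i) G) (at s)"
proof (rule has_vector_derivative_by_test_functions[of UNIV "\<lambda>s. tr (s *\<^sub>R i) G", simplified])
  show "continuous_on UNIV (\<lambda>s. tr (s *\<^sub>R i) G)" by (rule tr_continuous[OF i])
  fix \<phi> :: "'a \<Rightarrow> real" and r :: real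
  assume \<phi>: "test_function \<phi>"
  let ?d = "cls (\<lambda>x. frechet_derivative \<phi> (at x) i)"
  have "((\<lambda>s. tr (s *\<^sub>R i) (cls \<phi>)) has_vector_derivative tr ((- r) *\<^sub>R i) ?d) (at (- r))"
    by (intro tr_orbit_has_derivative tr_test_has_derivative_0 \<phi> i)
  moreover have "(uminus has_vector_derivative - 1) (at r)"
    by (auto intro!: derivative_eq_intros)
  ultimately have "((\<lambda>s. tr ((- s) *\<^sub>R i) (cls \<phi>)) has_vector_derivative (- 1) *\<^sub>R tr ((- r) *\<^sub>R i) ?d) (at r)"
    using vector_diff_chain_at[of uminus "-1" r "\<lambda>s. tr (s *\<^sub>R i) (cls \<phi>)"] by (simp add: o_def)
  from bounded_linear.has_vector_derivative[OF bounded_linear_inner_right[of F] this]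
  have "((\<lambda>s. tr (s *\<^sub>R i) F \<bullet> cls \<phi>) has_vector_derivative - (tr (r *\<^sub>R i) F \<bullet> ?d)) (at r)"
    by (simp add: inner_tr_left)
  moreover have "- (tr (r *\<^sub>R i) F \<bullet> ?d) = tr (r *\<^sub>R i) G \<bullet> cls \<phi>"
    using wderiv_tr[OF i d] \<phi> by (simp add: wderiv_def)
  ultimately show "((\<lambda>s. tr (s *\<^sub>R i) F \<bullet> cls \<phi>) has_real_derivative tr (r *\<^sub>R i) G \<bullet> cls \<phi>) (at r)"
    by (simp add: has_real_derivative_iff_has_vector_derivative)
qed

text \<open>The inner product of two functions translated simultaneously is constant; its derivative at 0 is
\<open>F \<bullet> G' + F' \<bullet> G\<close> by the product rule.\<close>

theorem wderiv_by_parts: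
  assumes i: "i \<in> Basis" and d: "wderiv i F F'" "wderiv i G G'"
  shows "F \<bullet> G' = - (F' \<bullet> G)"
proof -
  have "((\<lambda>s. tr (s *\<^sub>R i) F \<bullet> tr (s *\<^sub>R i) G) has_vector_derivative F \<bullet> G' + F' \<bullet> G) (at 0)"
    using bounded_bilinear.has_vector_derivative[OF bounded_bilinear_inner
        wderiv_orbit_derivative[OF i d(1), of 0] wderiv_orbit_derivative[OF i d(2), of 0]] by simp
  then have "((\<lambda>s::real. F \<bullet> G) has_vector_derivative F \<bullet> G' + F' \<bullet> G) (at 0)"
    by (simp add: inner_tr_tr)
  then have "F \<bullet> G' + F' \<bullet> G = 0"
    using vector_derivative_unique_at has_vector_derivative_const by blast
  then show ?thesis by simp
qed

section \<open>Difference quotients\<close>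

definition diffq :: "real \<Rightarrow> 'a::euclidean_space \<Rightarrow> 'a l2 \<Rightarrow> 'a l2" where
  "diffq h i F = (1 / h) *\<^sub>R (tr (h *\<^sub>R i) F - F)"

lemma bounded_linear_diffq: "bounded_linear (diffq h i)"
  unfolding diffq_def
  by (intro bounded_linear_scaleR_right[THEN bounded_linear_compose] bounded_linear_sub
      bounded_linear_tr bounded_linear_ident)

lemma diffq_diff: "diffq h i (F - G) = diffq h i F - diffq h i G"
  by (simp add: diffq_def tr_diff algebra_simps)

lemma wderiv_diffq:
  "j \<in> Basis \<Longrightarrow> wderiv j F G \<Longrightarrow> wderiv j (diffq h i F) (diffq h i G)"
  unfolding diffq_def by (intro wderiv_scaleR wderiv_diff wderiv_tr)

lemma diffq_tendsto:
  assumes "i \<in> Basis" "wderiv i F G"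
  shows "((\<lambda>h. diffq h i F) \<longlongrightarrow> G) (at 0)"
  using wderiv_orbit_derivative[OF assms, of 0]
  unfolding has_vector_derivative_iff_quotient by (simp add: diffq_def)

lemma norm_diffq_le:
  assumes "i \<in> Basis" "wderiv i F G"
  shows "norm (diffq h i F) \<le> norm G"
proof -
  have "norm (tr (h *\<^sub>R i) F - tr (0 *\<^sub>R i) F) \<le> norm G * norm (h - 0)"
  proof (rule differentiable_bound[of UNIV])
    show "((\<lambda>s. tr (s *\<^sub>R i) F) has_derivative (\<lambda>r. r *\<^sub>R tr (s *\<^sub>R i) G)) (at s)" for s
      using wderiv_orbit_derivative[OF assms] by (simp add: has_vector_derivative_def)
    show "onorm (\<lambda>r. r *\<^sub>R tr (s *\<^sub>R i) G) \<le> norm G" for s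
      by (rule onorm_bound) auto
  qed auto
  then show ?thesis
    by (cases "h = 0") (simp_all add: diffq_def divide_le_eq)
qed

text \<open>A forward followed by a backward quotient is the centred second difference.\<close>

definition dlap :: "real \<Rightarrow> 'a::euclidean_space l2 \<Rightarrow> 'a l2" where
  "dlap h F = (\<Sum>i\<in>Basis. diffq (- h) i (diffq h i F))"

lemma bounded_linear_dlap: "bounded_linear (dlap h)"
  unfolding dlap_def
  by (intro bounded_linear_sum bounded_linear_compose[OF bounded_linear_diffq] bounded_linear_diffq)

lemma wderiv_dlap: "j \<in> Basis \<Longrightarrow> wderiv j F G \<Longrightarrow> wderiv j (dlap h F) (dlap h G)"
  unfolding dlap_def by (intro wderiv_sum wderiv_diffq)

lemma norm_dlap_le:
  assumes "\<And>i. i \<in> Basis \<Longrightarrow> wderiv i F (G i)" "\<And>i. i \<in> Basis \<Longrightarrow> wderiv i (G i) (H i)"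
  shows "norm (dlap h F) \<le> (\<Sum>i\<in>Basis. norm (H i))"
  unfolding dlap_def
proof (rule sum_norm_le)
  fix i :: 'a assume i: "i \<in> Basis"
  have "norm (diffq (- h) i (diffq h i F)) \<le> norm (diffq h i (G i))"
    by (rule norm_diffq_le[OF i wderiv_diffq[OF i assms(1)[OF i]]])
  also have "\<dots> \<le> norm (H i)"
    by (rule norm_diffq_le[OF i assms(2)[OF i]])
  finally show "norm (diffq (- h) i (diffq h i F)) \<le> norm (H i)" .
qed

text \<open>The norm of a backward quotient is bounded, uniformly in \<open>h\<close>, by the norm of the weak derivative. For the error
\<open>diffq h i F - G i\<close> of the forward quotient, this derivative is the error of the forward quotient of \<open>G i\<close>, which
tends to 0.\<close>

lemma dlap_tendsto:
  assumes "\<And>i. i \<in> Basis \<Longrightarrow> wderiv i F (G i)" "\<And>i. i \<in> Basis \<Longrightarrow> wderiv i (G i) (H i)"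
  shows "((\<lambda>h. dlap h F) \<longlongrightarrow> (\<Sum>i\<in>Basis. H i)) (at 0)"
  unfolding dlap_def
proof (rule tendsto_sum)
  fix i :: 'a assume i: "i \<in> Basis"
  have "((\<lambda>h. diffq h i (G i)) \<longlongrightarrow> H i) (at 0)"
    by (rule diffq_tendsto[OF i assms(2)[OF i]])
  then have "((\<lambda>h. norm (diffq h i (G i) - H i)) \<longlongrightarrow> 0) (at 0)"
    by (simp add: LIM_zero tendsto_norm_zero)
  moreover have "\<forall>h. norm (diffq (- h) i (diffq h i F - G i)) \<le> norm (diffq h i (G i) - H i)"
    by (intro allI norm_diffq_le wderiv_diff wderiv_diffq i assms)
  ultimately have "((\<lambda>h. diffq (- h) i (diffq h i F - G i)) \<longlongrightarrow> 0) (at 0)"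
    using Lim_null_comparison[OF always_eventually, of "\<lambda>h. diffq (- h) i (diffq h i F - G i)"
        "\<lambda>h. norm (diffq h i (G i) - H i)"] by simp
  moreover have "((\<lambda>h. diffq (- h) i (G i)) \<longlongrightarrow> H i) (at 0)"
  proof (rule filterlim_compose[OF diffq_tendsto[OF i assms(2)[OF i]]])
    show "filterlim uminus (at 0) (at (0 :: real))"
      unfolding filterlim_at using tendsto_minus[OF tendsto_ident_at, of "0::real" UNIV]
      by (simp add: eventually_at_filter)
  qed
  ultimately show "((\<lambda>h. diffq (- h) i (diffq h i F)) \<longlongrightarrow> H i) (at 0)"
    using tendsto_add[of "\<lambda>h. diffq (- h) i (diffq h i F - G i)" 0 "at 0" "\<lambda>h. diffq (- h) i (G i)" "H i"]
    by (simp add: diffq_diff)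
qed

section \<open>The conservation law for curves in the Hilbert space\<close>

lemma inner_has_real_derivative:
  fixes F G :: "real \<Rightarrow> 'b::real_inner"
  assumes "(F has_vector_derivative F') (at t within S)" "(G has_vector_derivative G') (at t within S)"
  shows "((\<lambda>r. F r \<bullet> G r) has_real_derivative F t \<bullet> G' + F' \<bullet> G t) (at t within S)"
  using bounded_bilinear.has_vector_derivative[OF bounded_bilinear_inner assms]
  by (simp add: has_real_derivative_iff_has_vector_derivative)

text \<open>The terms of the functional without third derivatives of \<open>u\<close>. Here \<open>s1\<close> and \<open>s2\<close> stand for \<open>s'\<close> and \<open>s''\<close>,
  \<open>P\<close> for \<open>\<parallel>\<nabla>u\<^sub>t\<parallel>\<^sup>2\<close> and \<open>L\<close> for \<open>\<parallel>\<Delta>u\<parallel>\<^sup>2\<close>.\<close>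

definition lower_part :: "real \<Rightarrow> real \<Rightarrow> real \<Rightarrow> real \<Rightarrow> real \<Rightarrow> real \<Rightarrow> real" where
  "lower_part a q s1 s2 P L = 1 / 8 * (a * s1)\<^sup>2 * (q * P + L / q) - a / 16 * (a\<^sup>2 * s1 ^ 4 / 4 + q\<^sup>2 * s2\<^sup>2)"

text \<open>With \<open>k = q P + L / q\<close> one finds \<open>k' = q' s'' / 2\<close> and \<open>(q s'')' = 2 (q' k - 4 M) / q\<close>. In the derivative, the
contribution of \<open>k'\<close> cancels that of \<open>s' ^ 4\<close>, the two terms with \<open>q' q'' k\<close> cancel, and only the term with \<open>M\<close>
remains.\<close>

lemma lower_part_has_derivative:
  fixes q s1 P L :: "real \<Rightarrow> real"
  defines "s2 \<equiv> \<lambda>r. 2 * P r - 2 / (q r)\<^sup>2 * L r"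
  assumes q: "(q has_real_derivative a * s1 t) (at t within S)" "q t \<noteq> 0"
    and s1: "(s1 has_real_derivative s2 t) (at t within S)"
    and P: "(P has_real_derivative - 2 / (q t)\<^sup>2 * M) (at t within S)"
    and L: "(L has_real_derivative 2 * M) (at t within S)"
  shows "((\<lambda>r. lower_part a (q r) (s1 r) (s2 r) (P r) (L r)) has_real_derivative a * s2 t * M) (at t within S)"
proof -
  define k where "k r = q r * P r + L r / q r" for r
  define m where "m r = q r * s2 r" for r
  have k: "(k has_real_derivative a * s1 t * s2 t / 2) (at t within S)"
    unfolding k_def[abs_def] s2_def using q(2)
    by (auto intro!: derivative_eq_intros q(1) P L simp: field_simps power2_eq_square power3_eq_cube)
  define m' where "m' = 2 * (a * s1 t * k t - 4 * M) / q t"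
  have m: "(m has_real_derivative m') (at t within S)"
  proof -
    have q2: "((\<lambda>r. (q r)\<^sup>2) has_real_derivative 2 * q t * (a * s1 t)) (at t within S)"
      using DERIV_power[OF q(1), of 2] by (simp add: mult_ac)
    have "((\<lambda>r. 2 / (q r)\<^sup>2) has_real_derivative - 4 * (a * s1 t) / q t ^ 3) (at t within S)"
      using q(2) by (intro DERIV_cong[OF DERIV_divide[OF DERIV_const q2]])
        (auto simp: field_simps power2_eq_square power3_eq_cube)
    note d = DERIV_mult[OF q(1) DERIV_diff[OF DERIV_cmult[OF P, of 2] DERIV_mult[OF this L]]]
    show ?thesis
      unfolding m_def[abs_def] m'_def k_def s2_def
      by (rule DERIV_cong[OF d]) (use q(2) in \<open>simp add: field_simps power2_eq_square power3_eq_cube\<close>)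
  qed
  have "((\<lambda>r. 1 / 8 * (a * s1 r)\<^sup>2 * k r - a / 16 * (a\<^sup>2 * s1 r ^ 4 / 4 + (m r)\<^sup>2))
      has_real_derivative 1 / 8 * (2 * (a * s1 t) * (a * s2 t)) * k t +
        1 / 8 * (a * s1 t)\<^sup>2 * (a * s1 t * s2 t / 2) -
        a / 16 * (a\<^sup>2 * (4 * s1 t ^ 3 * s2 t) / 4 + 2 * m t * m'))
      (at t within S)"
    by (auto intro!: derivative_eq_intros k m s1 simp: algebra_simps power2_eq_square power3_eq_cube)
  moreover have "1 / 8 * (2 * (a * s1 t) * (a * s2 t)) * k t +
        1 / 8 * (a * s1 t)\<^sup>2 * (a * s1 t * s2 t / 2) -
        a / 16 * (a\<^sup>2 * (4 * s1 t ^ 3 * s2 t) / 4 + 2 * m t * m')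
      = a * s2 t * M"
  proof -
    have *: "2 * m t * m' = 4 * s2 t * (a * s1 t * k t - 4 * M)"
      using q(2) by (simp add: m_def m'_def)
    show ?thesis unfolding * by (simp add: algebra_simps power2_eq_square power3_eq_cube)
  qed
  ultimately show ?thesis
    by (simp add: lower_part_def power_mult_distrib k_def m_def)
qed

text \<open>\<open>U\<close> and \<open>V\<close> are the solution and its velocity. The curves \<open>U1 i\<close>, \<open>U2 i\<close>, \<open>V1 i\<close>, \<open>V2 i\<close> are their first and pure second
partial derivatives in direction \<open>i\<close>, and \<open>W i\<close> is the partial derivative of the Laplacian of \<open>U\<close>. Assumption
\<open>U1_H2\<close> supplies the second derivatives of \<open>U1 i\<close> in all directions, for which difference quotients of \<open>U1 i\<close>
converge; their sum over the directions turns out to be \<open>W i\<close>.\<close>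

locale kirchhoff_l2 =
  fixes a b T :: real
    and U V :: "real \<Rightarrow> 'a::euclidean_space l2"
    and U1 V1 U2 V2 W :: "'a \<Rightarrow> real \<Rightarrow> 'a l2"
  assumes U1: "\<And>i t. i \<in> Basis \<Longrightarrow> t \<in> {0..<T} \<Longrightarrow> wderiv i (U t) (U1 i t)"
    and U2: "\<And>i t. i \<in> Basis \<Longrightarrow> t \<in> {0..<T} \<Longrightarrow> wderiv i (U1 i t) (U2 i t)"
    and V1: "\<And>i t. i \<in> Basis \<Longrightarrow> t \<in> {0..<T} \<Longrightarrow> wderiv i (V t) (V1 i t)"
    and V2: "\<And>i t. i \<in> Basis \<Longrightarrow> t \<in> {0..<T} \<Longrightarrow> wderiv i (V1 i t) (V2 i t)"
    and W: "\<And>i t. i \<in> Basis \<Longrightarrow> t \<in> {0..<T} \<Longrightarrow> wderiv i (\<Sum>j\<in>Basis. U2 j t) (W i t)"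
    and U1_H2: "\<And>i j t. i \<in> Basis \<Longrightarrow> j \<in> Basis \<Longrightarrow> t \<in> {0..<T} \<Longrightarrow>
      \<exists>G H. wderiv j (U1 i t) G \<and> wderiv j G H"
    and U': "\<And>t. t \<in> {0..<T} \<Longrightarrow> (U has_vector_derivative V t) (at t within {0..<T})"
    and U1': "\<And>i t. i \<in> Basis \<Longrightarrow> t \<in> {0..<T} \<Longrightarrow> (U1 i has_vector_derivative V1 i t) (at t within {0..<T})"
    and U2': "\<And>i t. i \<in> Basis \<Longrightarrow> t \<in> {0..<T} \<Longrightarrow> (U2 i has_vector_derivative V2 i t) (at t within {0..<T})"
    and V2_cont: "\<And>i. i \<in> Basis \<Longrightarrow> continuous_on {0..<T} (V2 i)"
    and W_cont: "\<And>i. i \<in> Basis \<Longrightarrow> continuous_on {0..<T} (W i)"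
    and q_nonzero: "\<And>t. t \<in> {0..<T} \<Longrightarrow> a * (\<Sum>i\<in>Basis. U1 i t \<bullet> U1 i t) + b \<noteq> 0"
    and equation: "\<And>\<phi> t. test_function \<phi> \<Longrightarrow> t \<in> {0..<T} \<Longrightarrow>
      ((\<lambda>r. V r \<bullet> cls \<phi>) has_real_derivative
        ((1 / (a * (\<Sum>i\<in>Basis. U1 i t \<bullet> U1 i t) + b)\<^sup>2) *\<^sub>R (\<Sum>j\<in>Basis. U2 j t)) \<bullet> cls \<phi>) (at t within {0..<T})"
begin

abbreviation "J \<equiv> {0..<T}"
definition "s t = (\<Sum>i\<in>Basis. U1 i t \<bullet> U1 i t)"
definition "q t = a * s t + b"
definition "s1 t = 2 * (\<Sum>i\<in>Basis. U1 i t \<bullet> V1 i t)"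
definition "LU t = (\<Sum>i\<in>Basis. U2 i t)"
definition "LV t = (\<Sum>i\<in>Basis. V2 i t)"
definition "P t = (\<Sum>i\<in>Basis. V1 i t \<bullet> V1 i t)"
definition "s2 t = 2 * P t - 2 / (q t)\<^sup>2 * (LU t \<bullet> LU t)"

lemma q_nz: "t \<in> J \<Longrightarrow> q t \<noteq> 0"
  using q_nonzero by (simp add: q_def s_def)

lemma W_LU: "i \<in> Basis \<Longrightarrow> t \<in> J \<Longrightarrow> wderiv i (LU t) (W i t)"
  using W by (simp add: LU_def)

lemma LU': "t \<in> J \<Longrightarrow> (LU has_vector_derivative LV t) (at t within J)"
  unfolding LU_def[abs_def] LV_def by (intro has_vector_derivative_sum U2')

lemma s':
  assumes t: "t \<in> J"
  shows "(s has_real_derivative s1 t) (at t within J)"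
proof -
  have "(s has_real_derivative (\<Sum>i\<in>Basis. U1 i t \<bullet> V1 i t + V1 i t \<bullet> U1 i t)) (at t within J)"
    unfolding s_def[abs_def] by (intro DERIV_sum inner_has_real_derivative U1' t)
  moreover have "(\<Sum>i\<in>Basis. U1 i t \<bullet> V1 i t + V1 i t \<bullet> U1 i t) = s1 t"
    by (simp add: s1_def inner_commute[of "V1 _ t"] sum_distrib_left)
  ultimately show ?thesis by simp
qed

lemma q': "t \<in> J \<Longrightarrow> (q has_real_derivative a * s1 t) (at t within J)"
  unfolding q_def[abs_def] using DERIV_add[OF DERIV_cmult[OF s'] DERIV_const] by simp

lemma q_cont: "continuous_on J q"
  by (rule DERIV_continuous_on) (rule q')

text \<open>The right-hand side of the equation is continuous in \<open>'a l2\<close>, so the distributional \<open>u\<^sub>t\<^sub>t\<close> is a derivative in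
  norm.\<close>

lemma V': "t \<in> J \<Longrightarrow> (V has_vector_derivative (1 / (q t)\<^sup>2) *\<^sub>R LU t) (at t within J)"
proof (rule has_vector_derivative_by_test_functions)
  show "continuous_on J (\<lambda>t. (1 / (q t)\<^sup>2) *\<^sub>R LU t)"
    using q_nz continuous_on_vector_derivative[OF LU'] by (intro continuous_intros q_cont) auto
  show "((\<lambda>r. V r \<bullet> cls \<phi>) has_real_derivative ((1 / (q r)\<^sup>2) *\<^sub>R LU r) \<bullet> cls \<phi>) (at r within J)"
    if "test_function \<phi>" "r \<in> J" for \<phi> r
    using equation[OF that] unfolding q_def s_def LU_def .
qed auto

text \<open>Testing \<open>\<partial>\<^sub>i V\<close> against \<open>\<phi>\<close> is testing \<open>V\<close> against \<open>- \<partial>\<^sub>i \<phi>\<close>, so the equation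
  differentiated in \<open>x\<^sub>i\<close> holds weakly, and strongly since \<open>W\<close> is continuous.\<close>

lemma V1': "i \<in> Basis \<Longrightarrow> t \<in> J \<Longrightarrow> (V1 i has_vector_derivative (1 / (q t)\<^sup>2) *\<^sub>R W i t) (at t within J)"
proof (rule has_vector_derivative_by_test_functions)
  assume i: "i \<in> Basis"
  show "continuous_on J (\<lambda>t. (1 / (q t)\<^sup>2) *\<^sub>R W i t)"
    using q_nz by (intro continuous_intros q_cont W_cont i) auto
  fix \<phi> :: "'a \<Rightarrow> real" and r assume \<phi>: "test_function \<phi>" and r: "r \<in> J"
  let ?d = "cls (\<lambda>x. frechet_derivative \<phi> (at x) i)"
  have "((\<lambda>r. V r \<bullet> ?d) has_real_derivative (1 / (q r)\<^sup>2) *\<^sub>R LU r \<bullet> ?d) (at r within J)"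
    using inner_has_real_derivative[OF V'[OF r] has_vector_derivative_const[of ?d]] by simp
  then have "((\<lambda>r. - (V r \<bullet> ?d)) has_real_derivative - ((1 / (q r)\<^sup>2) *\<^sub>R LU r \<bullet> ?d)) (at r within J)"
    by (rule DERIV_minus)
  moreover have "LU r \<bullet> ?d = - (W i r \<bullet> cls \<phi>)"
    using W_LU[OF i r] \<phi> by (simp add: wderiv_def)
  ultimately have "((\<lambda>r. - (V r \<bullet> ?d)) has_real_derivative ((1 / (q r)\<^sup>2) *\<^sub>R W i r) \<bullet> cls \<phi>) (at r within J)"
    by simp
  then show "((\<lambda>r. V1 i r \<bullet> cls \<phi>) has_real_derivative ((1 / (q r)\<^sup>2) *\<^sub>R W i r) \<bullet> cls \<phi>) (at r within J)"
  proof (rule has_field_derivative_transform_within[OF _ zero_less_one r])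
    show "- (V x \<bullet> ?d) = V1 i x \<bullet> cls \<phi>" if "x \<in> J" for x
      using V1[OF i that] \<phi> by (simp add: wderiv_def)
  qed
qed auto

lemma grad_U_grad_LU: "t \<in> J \<Longrightarrow> (\<Sum>i\<in>Basis. U1 i t \<bullet> W i t) = - (LU t \<bullet> LU t)"
  using wderiv_by_parts[OF _ U2 W_LU] by (simp add: LU_def[of t] inner_sum_left sum_negf)

lemma grad_V_grad_LU: "t \<in> J \<Longrightarrow> (\<Sum>i\<in>Basis. V1 i t \<bullet> W i t) = - (LU t \<bullet> LV t)"
  using wderiv_by_parts[OF _ V2 W_LU] by (simp add: LV_def[of t] inner_sum_left sum_negf inner_commute[of "LU t"])

lemma s1':
  assumes t: "t \<in> J"
  shows "(s1 has_real_derivative s2 t) (at t within J)"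
proof -
  have "(s1 has_real_derivative 2 * (\<Sum>i\<in>Basis. U1 i t \<bullet> ((1 / (q t)\<^sup>2) *\<^sub>R W i t) + V1 i t \<bullet> V1 i t)) (at t within J)"
    unfolding s1_def[abs_def] by (intro DERIV_cmult DERIV_sum inner_has_real_derivative U1' V1' t)
  moreover have "2 * (\<Sum>i\<in>Basis. U1 i t \<bullet> ((1 / (q t)\<^sup>2) *\<^sub>R W i t) + V1 i t \<bullet> V1 i t) = s2 t"
    using grad_U_grad_LU[OF t] by (simp add: s2_def P_def sum.distrib flip: sum_divide_distrib)
  ultimately show ?thesis by simp
qed

lemma P':
  assumes t: "t \<in> J"
  shows "(P has_real_derivative - 2 / (q t)\<^sup>2 * (LU t \<bullet> LV t)) (at t within J)"
proof -
  have "(P has_real_derivative (\<Sum>i\<in>Basis. V1 i t \<bullet> ((1 / (q t)\<^sup>2) *\<^sub>R W i t) + ((1 / (q t)\<^sup>2) *\<^sub>R W i t) \<bullet> V1 i t)) (at t within J)"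
    unfolding P_def[abs_def] by (intro DERIV_sum inner_has_real_derivative V1' t)
  moreover have "(\<Sum>i\<in>Basis. V1 i t \<bullet> ((1 / (q t)\<^sup>2) *\<^sub>R W i t) + ((1 / (q t)\<^sup>2) *\<^sub>R W i t) \<bullet> V1 i t)
      = 2 / (q t)\<^sup>2 * (\<Sum>i\<in>Basis. V1 i t \<bullet> W i t)"
    by (simp add: inner_commute[of "W _ t"] sum_distrib_left)
  ultimately show ?thesis by (simp add: grad_V_grad_LU[OF t])
qed

lemma lower_part':
  assumes t: "t \<in> J"
  shows "((\<lambda>t. lower_part a (q t) (s1 t) (s2 t) (P t) (LU t \<bullet> LU t)) has_real_derivative
    a * s2 t * (LU t \<bullet> LV t)) (at t within J)"
proof -
  have "((\<lambda>t. LU t \<bullet> LU t) has_real_derivative 2 * (LU t \<bullet> LV t)) (at t within J)"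
    using inner_has_real_derivative[OF LU'[OF t] LU'[OF t]] by (simp add: inner_commute)
  from lower_part_has_derivative[OF q'[OF t] q_nz[OF t] s1'[OF t, unfolded s2_def] P'[OF t] this]
  show ?thesis by (simp add: s2_def)
qed

text \<open>The terms with third derivatives, with the outer Laplacian replaced by its difference version. In the middle term the
difference Laplacian acts on the gradient, where it approximates the gradient of the Laplacian.\<close>

definition "upper_part h t = q t * (dlap h (V t) \<bullet> dlap h (V t)) +
  (\<Sum>i\<in>Basis. dlap h (U1 i t) \<bullet> dlap h (U1 i t)) / q t - a * s1 t * (dlap h (U t) \<bullet> dlap h (V t))"

text \<open>Put \<open>A = dlap h\<close>. Since \<open>A\<close> commutes with weak derivatives, integration by parts yields
\<open>\<Sum>\<^sub>i (A \<partial>\<^sub>i U) \<bullet> (A \<partial>\<^sub>i F) = - (A \<Delta>U) \<bullet> (A F)\<close> for \<open>F = U\<close> and \<open>F = V\<close>. With these two identities all terms cancel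
except the one from \<open>q''\<close>.\<close>

lemma upper_part':
  assumes t: "t \<in> J"
  shows "(upper_part h has_real_derivative - (a * s2 t * (dlap h (U t) \<bullet> dlap h (V t)))) (at t within J)"
proof -
  note lin = bounded_linear.has_vector_derivative[OF bounded_linear_dlap[of h]]
  have sc: "dlap h (c *\<^sub>R F) = c *\<^sub>R dlap h F" for c F
    using bounded_linear.linear[OF bounded_linear_dlap] by (rule linear_cmul)
  have su: "dlap h (LU t) = (\<Sum>i\<in>Basis. dlap h (U2 i t))"
    unfolding LU_def using bounded_linear.linear[OF bounded_linear_dlap] by (rule linear_sum)
  let ?A = "dlap h"
  let ?c = "1 / (q t)\<^sup>2"
  have UV: "(\<Sum>i\<in>Basis. ?A (U1 i t) \<bullet> ?A (V1 i t)) = - (?A (LU t) \<bullet> ?A (V t))"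
    using wderiv_by_parts[OF _ wderiv_dlap[OF _ U2] wderiv_dlap[OF _ V1]] t
    by (simp add: su inner_sum_left sum_negf)
  have UU: "(\<Sum>i\<in>Basis. ?A (U1 i t) \<bullet> ?A (U1 i t)) = - (?A (LU t) \<bullet> ?A (U t))"
    using wderiv_by_parts[OF _ wderiv_dlap[OF _ U2] wderiv_dlap[OF _ U1]] t
    by (simp add: su inner_sum_left sum_negf)
  have 1: "((\<lambda>t. ?A (V t) \<bullet> ?A (V t)) has_real_derivative 2 * ?c * (?A (LU t) \<bullet> ?A (V t))) (at t within J)"
    using inner_has_real_derivative[OF lin[OF V'[OF t]] lin[OF V'[OF t]]] by (simp add: sc inner_commute)
  have 2: "((\<lambda>t. \<Sum>i\<in>Basis. ?A (U1 i t) \<bullet> ?A (U1 i t)) has_real_derivative - 2 * (?A (LU t) \<bullet> ?A (V t))) (at t within J)"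
  proof -
    have "((\<lambda>t. \<Sum>i\<in>Basis. ?A (U1 i t) \<bullet> ?A (U1 i t)) has_real_derivative
        (\<Sum>i\<in>Basis. ?A (U1 i t) \<bullet> ?A (V1 i t) + ?A (V1 i t) \<bullet> ?A (U1 i t))) (at t within J)"
      by (intro DERIV_sum inner_has_real_derivative lin U1' t)
    moreover have "(\<Sum>i\<in>Basis. ?A (U1 i t) \<bullet> ?A (V1 i t) + ?A (V1 i t) \<bullet> ?A (U1 i t))
        = 2 * (\<Sum>i\<in>Basis. ?A (U1 i t) \<bullet> ?A (V1 i t))"
      by (simp add: inner_commute[of "?A (V1 _ t)"] sum_distrib_left)
    ultimately show ?thesis by (simp add: UV)
  qed
  have 3: "((\<lambda>t. ?A (U t) \<bullet> ?A (V t)) has_real_derivative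
      ?c * (?A (LU t) \<bullet> ?A (U t)) + ?A (V t) \<bullet> ?A (V t)) (at t within J)"
    using inner_has_real_derivative[OF lin[OF U'[OF t]] lin[OF V'[OF t]]] by (simp add: sc inner_commute)
  show ?thesis
    unfolding upper_part_def[abs_def]
    by (rule DERIV_cong[OF DERIV_diff[OF DERIV_add[OF DERIV_mult[OF q'[OF t] 1]
            DERIV_divide[OF 2 q'[OF t] q_nz[OF t]]] DERIV_mult[OF DERIV_cmult[OF s1'[OF t], of a] 3]]])
      (use q_nz[OF t] in \<open>simp add: UU field_simps power2_eq_square\<close>)
qed

definition "functional t = q t * (LV t \<bullet> LV t) + (\<Sum>i\<in>Basis. W i t \<bullet> W i t) / q t
  - a * s1 t * (LU t \<bullet> LV t) + lower_part a (q t) (s1 t) (s2 t) (P t) (LU t \<bullet> LU t)"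

lemma dlap_limits:
  assumes t: "t \<in> J"
  defines "h \<equiv> \<lambda>n. inverse (real (Suc n))"
  shows "(\<lambda>n. dlap (h n) (U t)) \<longlonglongrightarrow> LU t" "(\<lambda>n. dlap (h n) (V t)) \<longlonglongrightarrow> LV t"
    "\<And>i. i \<in> Basis \<Longrightarrow> (\<lambda>n. dlap (h n) (U1 i t)) \<longlonglongrightarrow> W i t"
proof -
  have h: "filterlim h (at 0) sequentially"
    unfolding filterlim_at h_def using LIMSEQ_inverse_real_of_nat by auto
  have conv: "(\<lambda>n. dlap (h n) F) \<longlonglongrightarrow> (\<Sum>j\<in>Basis. H j)"
    if "\<And>j. j \<in> Basis \<Longrightarrow> wderiv j F (G j)" "\<And>j. j \<in> Basis \<Longrightarrow> wderiv j (G j) (H j)" for F G H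
    by (rule filterlim_compose[OF dlap_tendsto[OF that] h])
  show U: "(\<lambda>n. dlap (h n) (U t)) \<longlonglongrightarrow> LU t"
    unfolding LU_def by (rule conv[OF U1 U2]) (use t in auto)
  show "(\<lambda>n. dlap (h n) (V t)) \<longlonglongrightarrow> LV t"
    unfolding LV_def by (rule conv[OF V1 V2]) (use t in auto)
  fix i :: 'a assume i: "i \<in> Basis"
  \<comment> \<open>The limit of the quotients is a sum of mixed derivatives; closedness of \<open>wderiv i\<close> identifies it with \<open>W i\<close>.\<close>
  obtain G H where GH: "\<And>j. j \<in> Basis \<Longrightarrow> wderiv j (U1 i t) (G j)" "\<And>j. j \<in> Basis \<Longrightarrow> wderiv j (G j) (H j)"
    using U1_H2[OF i _ t] by metis
  have lim: "(\<lambda>n. dlap (h n) (U1 i t)) \<longlonglongrightarrow> (\<Sum>j\<in>Basis. H j)"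
    by (rule conv[OF GH])
  have "wderiv i (LU t) (\<Sum>j\<in>Basis. H j)"
    by (rule wderiv_closed[OF U lim]) (intro wderiv_dlap U1 i t)
  then show "(\<lambda>n. dlap (h n) (U1 i t)) \<longlonglongrightarrow> W i t"
    using lim wderiv_unique[OF W_LU[OF i t]] by simp
qed

theorem functional_constant:
  assumes t: "t \<in> J"
  shows "functional t = functional 0"
proof -
  define h where "h n = inverse (real (Suc n))" for n
  define E where "E n r = upper_part (h n) r + lower_part a (q r) (s1 r) (s2 r) (P r) (LU r \<bullet> LU r)" for n r
  define D where "D n r = a * s2 r * (LU r \<bullet> LV r - dlap (h n) (U r) \<bullet> dlap (h n) (V r))" for n r
  define B where "B r = \<bar>a * s2 r\<bar> * (norm (LU r) * norm (LV r) +
    (\<Sum>i\<in>Basis. norm (U2 i r)) * (\<Sum>i\<in>Basis. norm (V2 i r)))" for r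
  have J: "{0..t} \<subseteq> J" "0 \<in> J" using t by auto
  have E': "(E n has_real_derivative D n r) (at r within J)" if "r \<in> J" for n r
    unfolding E_def[abs_def] D_def
    using DERIV_add[OF upper_part'[OF that, of "h n"] lower_part'[OF that]] by (simp add: algebra_simps)
  have int: "(D n has_integral E n t - E n 0) {0..t}" for n
    using t J by (intro fundamental_theorem_of_calculus)
      (auto simp: has_real_derivative_iff_has_vector_derivative[symmetric] intro!: DERIV_subset[OF E'])
  have U1_cont: "continuous_on J (U1 i)" "continuous_on J (V1 i)" "continuous_on J (U2 i)" if "i \<in> Basis" for i
    using continuous_on_vector_derivative[OF U1'[OF that]] continuous_on_vector_derivative[OF V1'[OF that]]
      continuous_on_vector_derivative[OF U2'[OF that]] by auto
  have LU_cont: "continuous_on J LU" "continuous_on J LV"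
    unfolding LU_def[abs_def] LV_def[abs_def] by (intro continuous_intros U1_cont V2_cont; assumption)+
  have "continuous_on J s2"
    unfolding s2_def[abs_def] P_def[abs_def]
    using q_nz by (intro continuous_intros U1_cont LU_cont q_cont) auto
  then have "continuous_on J B"
    unfolding B_def[abs_def] by (auto intro!: continuous_intros U1_cont V2_cont LU_cont)
  then have B: "B integrable_on {0..t}"
    using J integrable_continuous_interval continuous_on_subset by blast
  have bound: "norm (D n r) \<le> B r" if r: "r \<in> {0..t}" for n r
  proof -
    have rJ: "r \<in> J" using r J by blast
    have "norm (dlap (h n) (U r)) * norm (dlap (h n) (V r)) \<le> (\<Sum>i\<in>Basis. norm (U2 i r)) * (\<Sum>i\<in>Basis. norm (V2 i r))"
      using norm_dlap_le[OF U1 U2] norm_dlap_le[OF V1 V2] rJ by (intro mult_mono sum_nonneg) auto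
    then have "\<bar>LU r \<bullet> LV r - dlap (h n) (U r) \<bullet> dlap (h n) (V r)\<bar> \<le>
        norm (LU r) * norm (LV r) + (\<Sum>i\<in>Basis. norm (U2 i r)) * (\<Sum>i\<in>Basis. norm (V2 i r))"
      using Cauchy_Schwarz_ineq2[of "LU r" "LV r"] Cauchy_Schwarz_ineq2[of "dlap (h n) (U r)" "dlap (h n) (V r)"]
      by linarith
    then show ?thesis
      unfolding D_def B_def real_norm_def abs_mult[of "a * s2 r"] by (rule mult_left_mono) simp
  qed
  have lim: "(\<lambda>n. D n r) \<longlonglongrightarrow> 0" if r: "r \<in> {0..t}" for r
  proof -
    have rJ: "r \<in> J" using r J by blast
    have "(\<lambda>n. D n r) \<longlonglongrightarrow> a * s2 r * (LU r \<bullet> LV r - LU r \<bullet> LV r)"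
      unfolding D_def h_def by (intro tendsto_intros dlap_limits[OF rJ])
    then show ?thesis by simp
  qed
  have E_lim: "(\<lambda>n. E n r) \<longlonglongrightarrow> functional r" if "r \<in> J" for r
    unfolding E_def functional_def upper_part_def h_def
    by (intro tendsto_intros dlap_limits[OF that] q_nz[OF that])
  have "((\<lambda>_. 0) has_integral functional t - functional 0) {0..t}"
    by (rule has_integral_dominated_convergence[OF int B])
      (use bound lim tendsto_diff[OF E_lim[OF t] E_lim[OF J(2)]] in auto)
  then show ?thesis
    using has_integral_unique has_integral_0 by fastforce
qed

end

section \<open>From Sobolev functions to curves in the Hilbert space\<close>

lemma sobolev_imp_L2: "sobolev m f \<Longrightarrow> L2 f"
  by (cases m) auto

text \<open>The defining property of the chosen representative mentions only the class of \<open>f\<close>, so the choice itself agrees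
for equivalent functions. This makes the recursively defined Sobolev norms well defined on classes.\<close>

lemma weak_partial_cong:
  assumes "i \<in> Basis" "L2 f" "L2 g" "cls f = cls g"
  shows "weak_partial i f = weak_partial i g"
  using assms by (simp add: weak_partial_def has_weak_partial_iff)

lemma weak_partial_eqI:
  assumes i: "i \<in> Basis" and fg: "has_weak_partial i f g"
  shows "has_weak_partial i f (weak_partial i f)" "cls (weak_partial i f) = cls g"
proof -
  show "has_weak_partial i f (weak_partial i f)"
    unfolding weak_partial_def by (rule someI[of "has_weak_partial i f", OF fg])
  then show "cls (weak_partial i f) = cls g"
    using fg i wderiv_unique by (auto simp: has_weak_partial_iff)
qed

lemma sobolev_cong:
  assumes "L2 f" "L2 g" "cls f = cls g"
  shows "sobolev m f \<longleftrightarrow> sobolev m g"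
  using assms by (cases m) (simp_all add: has_weak_partial_iff)

lemma sobolev_norm_cong:
  assumes "L2 f" "L2 g" "cls f = cls g"
  shows "sobolev_norm m f = sobolev_norm m g"
  using norm_cls_sq[OF assms(1)] norm_cls_sq[OF assms(2)] assms(3)
  by (cases m) (auto simp: sobolev_norm_def weak_partial_cong[OF _ assms])

lemma sobolev_Suc_weak_partial:
  assumes "sobolev (Suc m) f" "i \<in> Basis"
  shows "has_weak_partial i f (weak_partial i f)" "sobolev m (weak_partial i f)"
    "wderiv i (cls f) (cls (weak_partial i f))" "L2 (weak_partial i f)"
proof -
  obtain g where g: "has_weak_partial i f g" "sobolev m g" using assms by auto
  note * = weak_partial_eqI[OF assms(2) g(1)]
  show "has_weak_partial i f (weak_partial i f)" by (rule *(1))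
  then show "wderiv i (cls f) (cls (weak_partial i f))" "L2 (weak_partial i f)"
    using assms(2) by (auto simp: has_weak_partial_iff)
  then show "sobolev m (weak_partial i f)"
    using sobolev_cong[OF _ sobolev_imp_L2[OF g(2)] *(2)] g(2) by blast
qed

lemma sobolev_norm_sq_nonneg: "0 \<le> sobolev_norm_sq m f"
  by (induction m arbitrary: f) (auto intro!: add_nonneg_nonneg sum_nonneg integral_nonneg_AE)

lemma norm_cls_le_sobolev_norm:
  assumes "L2 f"
  shows "norm (cls f) \<le> sobolev_norm m f"
proof -
  have "(norm (cls f))\<^sup>2 \<le> sobolev_norm_sq m f"
    using norm_cls_sq[OF assms] by (cases m) (auto intro!: sum_nonneg sobolev_norm_sq_nonneg)
  then show ?thesis
    unfolding sobolev_norm_def by (rule real_le_rsqrt)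
qed

lemma sobolev_norm_weak_partial_le:
  assumes "i \<in> Basis"
  shows "sobolev_norm m (weak_partial i f) \<le> sobolev_norm (Suc m) f"
proof -
  have "sobolev_norm_sq m (weak_partial i f) \<le> (\<Sum>i\<in>Basis. sobolev_norm_sq m (weak_partial i f))"
    using assms by (intro member_le_sum sobolev_norm_sq_nonneg) auto
  also have "\<dots> \<le> sobolev_norm_sq (Suc m) f"
    by (auto intro!: integral_nonneg_AE)
  finally show ?thesis by (simp add: sobolev_norm_def)
qed

lemma weak_partial_diff:
  assumes i: "i \<in> Basis" and f: "sobolev (Suc m) f" and g: "sobolev (Suc n) g"
  shows "L2 (weak_partial i (\<lambda>x. f x - g x))"
    "cls (weak_partial i (\<lambda>x. f x - g x)) = cls (weak_partial i f) - cls (weak_partial i g)"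
proof -
  note F = sobolev_Suc_weak_partial[OF f i] and G = sobolev_Suc_weak_partial[OF g i]
  note L = sobolev_imp_L2[OF f] sobolev_imp_L2[OF g]
  have "has_weak_partial i (\<lambda>x. f x - g x) (\<lambda>x. weak_partial i f x - weak_partial i g x)"
    using F G L i by (simp add: has_weak_partial_iff L2_diff cls_diff wderiv_diff)
  from weak_partial_eqI[OF i this] show "L2 (weak_partial i (\<lambda>x. f x - g x))"
    "cls (weak_partial i (\<lambda>x. f x - g x)) = cls (weak_partial i f) - cls (weak_partial i g)"
    using F(4) G(4) by (auto simp: has_weak_partial_def cls_diff)
qed

lemma weak_partial_diff_quotient:
  assumes i: "i \<in> Basis" and f: "sobolev (Suc m) f" and g: "sobolev (Suc n) g" and h: "sobolev (Suc k) h"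
  shows "L2 (weak_partial i (\<lambda>x. (f x - g x) / c - h x))"
    "cls (weak_partial i (\<lambda>x. (f x - g x) / c - h x)) =
      cls (\<lambda>x. (weak_partial i f x - weak_partial i g x) / c - weak_partial i h x)"
proof -
  note F = sobolev_Suc_weak_partial[OF f i] and G = sobolev_Suc_weak_partial[OF g i]
    and H = sobolev_Suc_weak_partial[OF h i]
  note L = sobolev_imp_L2[OF f] sobolev_imp_L2[OF g] sobolev_imp_L2[OF h]
  have "has_weak_partial i (\<lambda>x. (1 / c) * (f x - g x) - h x)
      (\<lambda>x. (1 / c) * (weak_partial i f x - weak_partial i g x) - weak_partial i h x)"
    using F G H L i
    by (simp only: has_weak_partial_iff L2_diff L2_scale cls_diff cls_scale wderiv_diff wderiv_scaleR simp_thms)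
  from weak_partial_eqI[OF i this] show "L2 (weak_partial i (\<lambda>x. (f x - g x) / c - h x))"
    "cls (weak_partial i (\<lambda>x. (f x - g x) / c - h x)) =
      cls (\<lambda>x. (weak_partial i f x - weak_partial i g x) / c - weak_partial i h x)"
    by (simp_all add: has_weak_partial_def)
qed

lemma sobolev_norm_nonneg: "0 \<le> sobolev_norm m f"
  by (simp add: sobolev_norm_def sobolev_norm_sq_nonneg)

text \<open>The comparison is only required in \<open>S\<close>, because curves of Sobolev functions are unconstrained outside the time
  interval.\<close>

lemma tendsto_zero_within:
  fixes f g :: "real \<Rightarrow> real"
  assumes "(g \<longlongrightarrow> 0) (at t within S)" "\<And>r. r \<in> S \<Longrightarrow> 0 \<le> f r" "\<And>r. r \<in> S \<Longrightarrow> f r \<le> g r"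
  shows "(f \<longlongrightarrow> 0) (at t within S)"
  by (rule tendsto_sandwich[OF _ _ tendsto_const assms(1)])
    (use assms(2,3) in \<open>auto simp: eventually_at_filter intro!: always_eventually\<close>)

text \<open>Differentiation lowers the Sobolev order by one. Iterating this and the next lemma down to order 0 turns continuity
and differentiability in Sobolev norms into the same properties of the classes of iterated partial derivatives.\<close>

lemma sobolev_continuous_weak_partial:
  assumes u: "sobolev_continuous T (Suc m) u" and i: "i \<in> Basis"
  shows "sobolev_continuous T m (\<lambda>t. weak_partial i (u t))"
  unfolding sobolev_continuous_def
proof (intro ballI conjI)
  fix t assume t: "t \<in> {0..<T}"
  have S: "sobolev (Suc m) (u r)" if "r \<in> {0..<T}" for r
    using u that unfolding sobolev_continuous_def by blast
  show "sobolev m (weak_partial i (u t))" by (rule sobolev_Suc_weak_partial(2)[OF S[OF t] i])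
  have lim: "((\<lambda>r. sobolev_norm (Suc m) (\<lambda>x. u r x - u t x)) \<longlongrightarrow> 0) (at t within {0..<T})"
    using u t unfolding sobolev_continuous_def by blast
  show "((\<lambda>r. sobolev_norm m (\<lambda>x. weak_partial i (u r) x - weak_partial i (u t) x)) \<longlongrightarrow> 0) (at t within {0..<T})"
  proof (rule tendsto_zero_within[OF lim sobolev_norm_nonneg])
    fix r assume r: "r \<in> {0..<T}"
    note D = weak_partial_diff[OF i S[OF r] S[OF t]]
    note W = sobolev_Suc_weak_partial(4)[OF S[OF r] i] sobolev_Suc_weak_partial(4)[OF S[OF t] i]
    have "sobolev_norm m (\<lambda>x. weak_partial i (u r) x - weak_partial i (u t) x)
        = sobolev_norm m (weak_partial i (\<lambda>x. u r x - u t x))"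
      by (rule sobolev_norm_cong) (simp_all add: D W L2_diff cls_diff)
    then show "sobolev_norm m (\<lambda>x. weak_partial i (u r) x - weak_partial i (u t) x)
        \<le> sobolev_norm (Suc m) (\<lambda>x. u r x - u t x)"
      using sobolev_norm_weak_partial_le[OF i] by metis
  qed
qed

lemma has_sobolev_time_derivative_weak_partial:
  assumes u: "has_sobolev_time_derivative T (Suc m) u v" and i: "i \<in> Basis"
  shows "has_sobolev_time_derivative T m (\<lambda>t. weak_partial i (u t)) (\<lambda>t. weak_partial i (v t))"
  unfolding has_sobolev_time_derivative_def
proof (intro ballI conjI)
  fix t assume t: "t \<in> {0..<T}"
  have S: "sobolev (Suc m) (u r)" "sobolev (Suc m) (v r)" if "r \<in> {0..<T}" for r
    using u that unfolding has_sobolev_time_derivative_def by blast+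
  show "sobolev m (weak_partial i (u t))" "sobolev m (weak_partial i (v t))"
    using sobolev_Suc_weak_partial(2)[OF S(1)[OF t] i] sobolev_Suc_weak_partial(2)[OF S(2)[OF t] i] .
  have lim: "((\<lambda>r. sobolev_norm (Suc m) (\<lambda>x. (u r x - u t x) / (r - t) - v t x)) \<longlongrightarrow> 0) (at t within {0..<T})"
    using u t unfolding has_sobolev_time_derivative_def by blast
  show "((\<lambda>r. sobolev_norm m (\<lambda>x. (weak_partial i (u r) x - weak_partial i (u t) x) / (r - t)
      - weak_partial i (v t) x)) \<longlongrightarrow> 0) (at t within {0..<T})"
  proof (rule tendsto_zero_within[OF lim sobolev_norm_nonneg])
    fix r assume r: "r \<in> {0..<T}"
    note D = weak_partial_diff_quotient[OF i S(1)[OF r] S(1)[OF t] S(2)[OF t], of "r - t"]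
    note W = sobolev_Suc_weak_partial(4)[OF S(1)[OF r] i] sobolev_Suc_weak_partial(4)[OF S(1)[OF t] i]
      sobolev_Suc_weak_partial(4)[OF S(2)[OF t] i]
    have "L2 (\<lambda>x. (weak_partial i (u r) x - weak_partial i (u t) x) / (r - t) - weak_partial i (v t) x)"
      using L2_diff[OF L2_scale[OF L2_diff[OF W(1,2)], of "1 / (r - t)"] W(3)] by simp
    then have "sobolev_norm m (\<lambda>x. (weak_partial i (u r) x - weak_partial i (u t) x) / (r - t) - weak_partial i (v t) x)
        = sobolev_norm m (weak_partial i (\<lambda>x. (u r x - u t x) / (r - t) - v t x))"
      using D by (intro sobolev_norm_cong) simp_all
    then show "sobolev_norm m (\<lambda>x. (weak_partial i (u r) x - weak_partial i (u t) x) / (r - t) - weak_partial i (v t) x)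
        \<le> sobolev_norm (Suc m) (\<lambda>x. (u r x - u t x) / (r - t) - v t x)"
      using sobolev_norm_weak_partial_le[OF i] by metis
  qed
qed

lemma sobolev_continuous_imp_continuous_cls:
  assumes u: "sobolev_continuous T m u"
  shows "continuous_on {0..<T} (\<lambda>t. cls (u t))"
  unfolding continuous_on_def
proof
  fix t assume t: "t \<in> {0..<T}"
  have L: "L2 (u r)" if "r \<in> {0..<T}" for r
    using u that sobolev_imp_L2 unfolding sobolev_continuous_def by blast
  have "((\<lambda>r. sobolev_norm m (\<lambda>x. u r x - u t x)) \<longlongrightarrow> 0) (at t within {0..<T})"
    using u t unfolding sobolev_continuous_def by blast
  then have "((\<lambda>r. norm (cls (u r) - cls (u t))) \<longlongrightarrow> 0) (at t within {0..<T})"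
  proof (rule tendsto_zero_within)
    show "norm (cls (u r) - cls (u t)) \<le> sobolev_norm m (\<lambda>x. u r x - u t x)" if "r \<in> {0..<T}" for r
      using norm_cls_le_sobolev_norm[OF L2_diff[OF L[OF that] L[OF t]], of m]
      by (simp only: cls_diff L that t)
  qed simp
  then show "((\<lambda>r. cls (u r)) \<longlongrightarrow> cls (u t)) (at t within {0..<T})"
    by (simp add: tendsto_norm_zero_iff LIM_zero_iff)
qed

lemma has_sobolev_time_derivative_imp_cls:
  assumes u: "has_sobolev_time_derivative T m u v" and t: "t \<in> {0..<T}"
  shows "((\<lambda>t. cls (u t)) has_vector_derivative cls (v t)) (at t within {0..<T})"
proof -
  have L: "L2 (u r)" "L2 (v r)" if "r \<in> {0..<T}" for r
    using u that sobolev_imp_L2 unfolding has_sobolev_time_derivative_def by blast+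
  have "((\<lambda>r. sobolev_norm m (\<lambda>x. (u r x - u t x) / (r - t) - v t x)) \<longlongrightarrow> 0) (at t within {0..<T})"
    using u t unfolding has_sobolev_time_derivative_def by blast
  then have "((\<lambda>r. norm ((1 / (r - t)) *\<^sub>R (cls (u r) - cls (u t)) - cls (v t))) \<longlongrightarrow> 0) (at t within {0..<T})"
  proof (rule tendsto_zero_within)
    fix r assume r: "r \<in> {0..<T}"
    have 1: "L2 (\<lambda>x. (1 / (r - t)) * (u r x - u t x) - v t x)"
      using r t by (intro L2_diff L2_scale L)
    have 2: "cls (\<lambda>x. (1 / (r - t)) * (u r x - u t x) - v t x)
        = (1 / (r - t)) *\<^sub>R (cls (u r) - cls (u t)) - cls (v t)"
      using r t L by (simp only: cls_diff cls_scale L2_diff L2_scale)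
    show "norm ((1 / (r - t)) *\<^sub>R (cls (u r) - cls (u t)) - cls (v t)) \<le>
        sobolev_norm m (\<lambda>x. (u r x - u t x) / (r - t) - v t x)"
      using norm_cls_le_sobolev_norm[OF 1, of m] unfolding 2 by simp
  qed simp
  then show ?thesis
    unfolding has_vector_derivative_iff_quotient by (simp add: tendsto_norm_zero_iff LIM_zero_iff)
qed

lemma at_within_Ico_neq_bot:
  assumes "t \<in> {0..<T}"
  shows "at t within {0..<T} \<noteq> (bot :: real filter)"
proof -
  have "t islimpt {t<..<T}" using assms by (intro islimpt_greaterThanLessThan1) auto
  then have "t islimpt {0..<T}" by (rule islimpt_subset) (use assms in auto)
  then show ?thesis by (simp add: trivial_limit_within)
qed

lemma time_deriv_eq:
  assumes "t \<in> {0..<T}" "(f has_real_derivative D) (at t within {0..<T})"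
  shows "time_deriv T f t = D"
  unfolding time_deriv_def
  by (rule vector_derivative_within[OF at_within_Ico_neq_bot[OF assms(1)]])
    (use assms(2) in \<open>simp add: has_real_derivative_iff_has_vector_derivative\<close>)

lemma sobolev_continuous_cong:
  assumes v: "sobolev_continuous T m v" and uv: "\<And>t. t \<in> {0..<T} \<Longrightarrow> L2 (u t) \<and> cls (u t) = cls (v t)"
  shows "sobolev_continuous T m u"
  unfolding sobolev_continuous_def
proof (intro ballI conjI)
  fix t assume t: "t \<in> {0..<T}"
  have L: "L2 (v r)" if "r \<in> {0..<T}" for r
    using v that sobolev_imp_L2 unfolding sobolev_continuous_def by blast
  show "sobolev m (u t)"
    using sobolev_cong[of "u t" "v t" m] uv[OF t] L[OF t] v t unfolding sobolev_continuous_def by blast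
  have lim: "((\<lambda>r. sobolev_norm m (\<lambda>x. v r x - v t x)) \<longlongrightarrow> 0) (at t within {0..<T})"
    using v t unfolding sobolev_continuous_def by blast
  show "((\<lambda>r. sobolev_norm m (\<lambda>x. u r x - u t x)) \<longlongrightarrow> 0) (at t within {0..<T})"
  proof (rule tendsto_zero_within[OF lim sobolev_norm_nonneg])
    show "sobolev_norm m (\<lambda>x. u r x - u t x) \<le> sobolev_norm m (\<lambda>x. v r x - v t x)" if "r \<in> {0..<T}" for r
      using uv[OF t] uv[OF that] L[OF t] L[OF that]
      by (intro eq_refl sobolev_norm_cong) (simp_all add: L2_diff cls_diff)
  qed
qed

lemma L2_norm_sq: "L2 f \<Longrightarrow> (L2_norm f)\<^sup>2 = cls f \<bullet> cls f"
  using norm_cls_sq[of f] by (simp add: L2_norm_def power2_norm_eq_inner)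

lemma integral_norm_grad_sq:
  assumes "\<And>i. i \<in> Basis \<Longrightarrow> L2 (weak_partial i f)"
  shows "(\<integral>x. (norm (grad f x))\<^sup>2 \<partial>lebesgue) = (\<Sum>i\<in>Basis. cls (weak_partial i f) \<bullet> cls (weak_partial i f))"
proof -
  have "(norm (grad f x))\<^sup>2 = (\<Sum>i\<in>Basis. weak_partial i f x * weak_partial i f x)" for x
    unfolding power2_norm_eq_inner
    by (subst euclidean_inner) (simp add: grad_def inner_sum_left_Basis)
  then show ?thesis
    using assms by (simp add: inner_cls L2_mult_integrable)
qed

lemma L2_norm_grad_sq:
  assumes "\<And>i. i \<in> Basis \<Longrightarrow> L2 (weak_partial i f)"
  shows "(L2_norm (grad f))\<^sup>2 = (\<Sum>i\<in>Basis. cls (weak_partial i f) \<bullet> cls (weak_partial i f))"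
  using integral_norm_grad_sq[OF assms] by (simp add: L2_norm_def sum_nonneg)

lemma sobolev_mono: "sobolev (Suc m) f \<Longrightarrow> sobolev m f"
  by (induction m arbitrary: f) (auto, blast)

lemma laplacian_cls:
  assumes "sobolev 2 f"
  shows "L2 (laplacian f)" "cls (laplacian f) = (\<Sum>i\<in>Basis. cls (weak_partial i (weak_partial i f)))"
proof -
  have L: "L2 (weak_partial i (weak_partial i f))" if "i \<in> Basis" for i
  proof -
    have "sobolev (Suc (Suc 0)) f" using assms by (simp add: numeral_2_eq_2)
    from sobolev_Suc_weak_partial(4)[OF sobolev_Suc_weak_partial(2)[OF this that] that] show ?thesis .
  qed
  show "L2 (laplacian f)" "cls (laplacian f) = (\<Sum>i\<in>Basis. cls (weak_partial i (weak_partial i f)))"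
    unfolding laplacian_def[abs_def] using L by (simp_all add: L2_sum cls_sum)
qed

lemma weak_partial_laplacian_cls:
  assumes f: "sobolev 3 f" and i: "i \<in> Basis"
  shows "L2 (weak_partial i (laplacian f))"
    "wderiv i (cls (laplacian f)) (cls (weak_partial i (laplacian f)))"
    "cls (weak_partial i (laplacian f)) = (\<Sum>j\<in>Basis. cls (weak_partial i (weak_partial j (weak_partial j f))))"
proof -
  have f3: "sobolev (Suc (Suc (Suc 0))) f" using f by (simp add: numeral_3_eq_3)
  then have f2: "sobolev 2 f" using sobolev_mono by (simp only: numeral_2_eq_2)
  have D: "sobolev (Suc 0) (weak_partial j (weak_partial j f))" if "j \<in> Basis" for j
    using sobolev_Suc_weak_partial(2)[OF sobolev_Suc_weak_partial(2)[OF f3 that] that] .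
  have "has_weak_partial i (laplacian f) (\<lambda>x. \<Sum>j\<in>Basis. weak_partial i (weak_partial j (weak_partial j f)) x)"
    unfolding has_weak_partial_iff[OF i]
    using sobolev_Suc_weak_partial(3,4)[OF D i]
    by (auto simp: laplacian_cls[OF f2] cls_sum intro!: L2_sum wderiv_sum)
  from weak_partial_eqI[OF i this]
  show "L2 (weak_partial i (laplacian f))"
    "wderiv i (cls (laplacian f)) (cls (weak_partial i (laplacian f)))"
    "cls (weak_partial i (laplacian f)) = (\<Sum>j\<in>Basis. cls (weak_partial i (weak_partial j (weak_partial j f))))"
    using sobolev_Suc_weak_partial(4)[OF D i] by (auto simp: has_weak_partial_iff[OF i] cls_sum)
qed

section \<open>The conserved functional\<close>

theorem theorem1p1:
  fixes a b T :: real
    and u ut :: "real \<Rightarrow> real ^ 'n \<Rightarrow> real"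
  assumes "a \<noteq> 0 \<or> b \<noteq> 0"
    and "T > 0"
    and "\<forall>k\<in>{0, 1}. C_k_sobolev k T (3 - k) u"
    and "has_sobolev_time_derivative T 2 u ut"
    and "\<forall>t\<in>{0..<T}. q_fun a b u t \<noteq> 0"
    and "kirchhoff_solution a b T u ut"
  shows "I3 a b T u ut constant_on {0..<T}"
proof -
  have u3: "sobolev_continuous T 3 u" using assms(3) by simp
  have "C_k_sobolev 1 T 2 u" using assms(3) by force
  then obtain v where v: "has_sobolev_time_derivative T 2 u v" "sobolev_continuous T 2 v" by auto
  have S: "sobolev 3 (u t)" "sobolev 2 (ut t)" "sobolev 2 (v t)" if "t \<in> {0..<T}" for t
    using u3 assms(4) v(1) that unfolding sobolev_continuous_def has_sobolev_time_derivative_def by blast+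
  \<comment> \<open>The velocity \<open>v\<close> from \<open>C\<^sup>1([0,T); H\<^sup>2)\<close> is continuous; \<open>ut\<close> inherits this, as both are the time derivative of \<open>u\<close>.\<close>
  have "cls (ut t) = cls (v t)" if "t \<in> {0..<T}" for t
    using vector_derivative_unique_within[OF at_within_Ico_neq_bot]
      has_sobolev_time_derivative_imp_cls[OF assms(4)] has_sobolev_time_derivative_imp_cls[OF v(1)] that by blast
  then have ut2: "sobolev_continuous T 2 ut"
    using S sobolev_imp_L2 by (intro sobolev_continuous_cong[OF v(2)]) blast
  have S': "sobolev (Suc (Suc (Suc 0))) (u t)" "sobolev (Suc (Suc 0)) (u t)" "sobolev (Suc (Suc 0)) (ut t)"
    "sobolev 2 (u t)" if "t \<in> {0..<T}" for t
    using S[OF that] sobolev_mono by (simp_all only: numeral_3_eq_3 numeral_2_eq_2)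
  define U V where "U t = cls (u t)" and "V t = cls (ut t)" for t
  define U1 V1 where "U1 i t = cls (weak_partial i (u t))" and "V1 i t = cls (weak_partial i (ut t))" for i t
  define U2 V2 where "U2 i t = cls (weak_partial i (weak_partial i (u t)))"
    and "V2 i t = cls (weak_partial i (weak_partial i (ut t)))" for i t
  define W where "W i t = cls (weak_partial i (laplacian (u t)))" for i t
  have L1: "L2 (weak_partial i (u t))" "L2 (weak_partial i (ut t))" if "t \<in> {0..<T}" "i \<in> Basis" for i t
    using sobolev_Suc_weak_partial(4) S'[OF that(1)] that(2) by blast+
  have lap: "cls (laplacian (u t)) = (\<Sum>j\<in>Basis. U2 j t)" "cls (laplacian (ut t)) = (\<Sum>j\<in>Basis. V2 j t)"
    "L2 (laplacian (u t))" "L2 (laplacian (ut t))"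
    if "t \<in> {0..<T}" for t
    using laplacian_cls[OF S'(4)[OF that]] laplacian_cls[OF S(2)[OF that]] by (simp_all add: U2_def V2_def)
  have grad_sq: "(\<integral>y. (norm (grad (u t) y))\<^sup>2 \<partial>lebesgue) = (\<Sum>i\<in>Basis. U1 i t \<bullet> U1 i t)"
    if "t \<in> {0..<T}" for t
    using integral_norm_grad_sq[OF L1(1)[OF that]] by (simp add: U1_def)
  have s_eq: "s_fun u t = (\<Sum>i\<in>Basis. U1 i t \<bullet> U1 i t)" if "t \<in> {0..<T}" for t
    using L2_norm_grad_sq[OF L1(1)[OF that]] by (simp add: U1_def s_fun_def)
  have ut_Suc: "has_sobolev_time_derivative T (Suc (Suc 0)) u ut" and v_Suc: "sobolev_continuous T (Suc (Suc 0)) ut"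
    and u_Suc: "sobolev_continuous T (Suc (Suc (Suc 0))) u"
    using assms(4) ut2 u3 by (simp_all only: numeral_2_eq_2 numeral_3_eq_3)
  interpret kirchhoff_l2 a b T U V U1 V1 U2 V2 W
  proof
    fix i t assume i: "i \<in> (Basis :: (real ^ 'n) set)" and t: "t \<in> {0..<T}"
    note p = sobolev_Suc_weak_partial(2)[OF _ i] and d = sobolev_Suc_weak_partial(3)[OF _ i]
    show "wderiv i (U t) (U1 i t)" "wderiv i (V t) (V1 i t)"
      unfolding U_def V_def U1_def V1_def using S'[OF t] d by blast+
    show "wderiv i (U1 i t) (U2 i t)" "wderiv i (V1 i t) (V2 i t)"
      unfolding U2_def V2_def U1_def V1_def using S'[OF t] p d by blast+
    show "wderiv i (\<Sum>j\<in>Basis. U2 j t) (W i t)"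
      using weak_partial_laplacian_cls(2)[OF S(1)[OF t] i] unfolding lap[OF t] W_def .
    show "\<exists>G H. wderiv j (U1 i t) G \<and> wderiv j G H" if j: "j \<in> Basis" for j
      using sobolev_Suc_weak_partial(3)[OF p[OF S'(1)[OF t]] j]
        sobolev_Suc_weak_partial(3)[OF sobolev_Suc_weak_partial(2)[OF p[OF S'(1)[OF t]] j] j]
      unfolding U1_def by blast
    show "(U1 i has_vector_derivative V1 i t) (at t within {0..<T})"
      unfolding U1_def[abs_def] V1_def
      by (rule has_sobolev_time_derivative_imp_cls[OF has_sobolev_time_derivative_weak_partial[OF ut_Suc i] t])
    show "(U2 i has_vector_derivative V2 i t) (at t within {0..<T})"
      unfolding U2_def[abs_def] V2_def
      by (rule has_sobolev_time_derivative_imp_cls[OF has_sobolev_time_derivative_weak_partial[OF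
            has_sobolev_time_derivative_weak_partial[OF ut_Suc i] i] t])
  next
    fix t assume t: "t \<in> {0..<T}"
    show "(U has_vector_derivative V t) (at t within {0..<T})"
      unfolding U_def[abs_def] V_def by (rule has_sobolev_time_derivative_imp_cls[OF assms(4) t])
    have "q_fun a b u t \<noteq> 0" using assms(5) t by blast
    then show "a * (\<Sum>i\<in>Basis. U1 i t \<bullet> U1 i t) + b \<noteq> 0"
      by (simp add: q_fun_def s_eq[OF t])
  next
    fix i :: "real ^ 'n" assume i: "i \<in> Basis"
    show "continuous_on {0..<T} (V2 i)"
      unfolding V2_def[abs_def]
      by (rule sobolev_continuous_imp_continuous_cls[OF sobolev_continuous_weak_partial[OF
            sobolev_continuous_weak_partial[OF v_Suc i] i]])
    have "continuous_on {0..<T} (\<lambda>t. \<Sum>j\<in>Basis. cls (weak_partial i (weak_partial j (weak_partial j (u t)))))"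
      using sobolev_continuous_imp_continuous_cls[OF sobolev_continuous_weak_partial[OF
          sobolev_continuous_weak_partial[OF sobolev_continuous_weak_partial[OF u_Suc]]]] i
      by (intro continuous_on_sum) auto
    then show "continuous_on {0..<T} (W i)"
      by (rule continuous_on_eq) (simp add: W_def weak_partial_laplacian_cls(3)[OF S(1) i])
  next
    fix \<phi> :: "real ^ 'n \<Rightarrow> real" and t assume \<phi>: "test_function \<phi>" and t: "t \<in> {0..<T}"
    note L = L2_test_function[OF \<phi>]
    let ?c = "1 / (a * (\<Sum>i\<in>Basis. U1 i t \<bullet> U1 i t) + b)\<^sup>2"
    let ?I = "\<integral>x. laplacian (u t) x / (a * (\<integral>y. (norm (grad (u t) y))\<^sup>2 \<partial>lebesgue) + b)\<^sup>2 * \<phi> x \<partial>lebesgue"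
    have "?I = (\<integral>x. (?c * laplacian (u t) x) * \<phi> x \<partial>lebesgue)"
      by (simp add: grad_sq[OF t])
    also have "\<dots> = (?c *\<^sub>R (\<Sum>j\<in>Basis. U2 j t)) \<bullet> cls \<phi>"
      unfolding lap(1)[OF t, symmetric] cls_scale[OF lap(3)[OF t], symmetric]
      by (rule inner_cls[OF L2_scale[OF lap(3)[OF t]] L, symmetric])
    finally have I: "?I = (?c *\<^sub>R (\<Sum>j\<in>Basis. U2 j t)) \<bullet> cls \<phi>" .
    have "((\<lambda>r. \<integral>x. ut r x * \<phi> x \<partial>lebesgue) has_real_derivative ?I) (at t within {0..<T})"
      using assms(6) \<phi> t unfolding kirchhoff_solution_def by blast
    then show "((\<lambda>r. V r \<bullet> cls \<phi>) has_real_derivative (?c *\<^sub>R (\<Sum>j\<in>Basis. U2 j t)) \<bullet> cls \<phi>) (at t within {0..<T})"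
      unfolding I
      by (rule has_field_derivative_transform_within[OF _ zero_less_one t])
        (simp add: V_def inner_cls sobolev_imp_L2[OF S(2)] L)
  qed
  have s_fun': "time_deriv T (s_fun u) t = s1 t" if t: "t \<in> {0..<T}" for t
    by (intro time_deriv_eq t has_field_derivative_transform_within[OF s'[OF t] zero_less_one t])
      (simp add: s_eq s_def)
  have q_fun': "time_deriv T (q_fun a b u) t = a * s1 t" if t: "t \<in> {0..<T}" for t
    by (intro time_deriv_eq t has_field_derivative_transform_within[OF q'[OF t] zero_less_one t])
      (simp add: q_fun_def q_def s_eq s_def)
  have s_fun'': "time_deriv T (time_deriv T (s_fun u)) t = s2 t" if t: "t \<in> {0..<T}" for t
    by (intro time_deriv_eq t has_field_derivative_transform_within[OF s1'[OF t] zero_less_one t])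
      (simp add: s_fun')
  have "I3 a b T u ut t = functional t" if t: "t \<in> {0..<T}" for t
  proof -
    have 1: "q_fun a b u t = q t" by (simp add: q_fun_def q_def s_eq[OF t] s_def)
    have 2: "(L2_norm (laplacian (ut t)))\<^sup>2 = LV t \<bullet> LV t" "(L2_norm (laplacian (u t)))\<^sup>2 = LU t \<bullet> LU t"
      using L2_norm_sq[OF lap(3)[OF t]] L2_norm_sq[OF lap(4)[OF t]] by (simp_all add: lap[OF t] LU_def LV_def)
    have 3: "(L2_norm (grad (laplacian (u t))))\<^sup>2 = (\<Sum>i\<in>Basis. W i t \<bullet> W i t)"
      using L2_norm_grad_sq[OF weak_partial_laplacian_cls(1)[OF S(1)[OF t]]] by (simp add: W_def)
    have 4: "(\<integral>x. laplacian (u t) x * laplacian (ut t) x \<partial>lebesgue) = LU t \<bullet> LV t"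
      using inner_cls[OF lap(3,4)[OF t]] by (simp add: lap[OF t] LU_def LV_def)
    have 5: "(L2_norm (grad (ut t)))\<^sup>2 = P t"
      using L2_norm_grad_sq[OF L1(2)[OF t]] by (simp add: P_def V1_def)
    show ?thesis
      unfolding I3_def functional_def lower_part_def Let_def 1 2 3 4 5 s_fun'[OF t] q_fun'[OF t] s_fun''[OF t] by simp
  qed
  then show ?thesis
    using functional_constant unfolding constant_on_def by metis
qed

end
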